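(* Suppose that the interarrival distribution $F$ is spread out and that $\mathbb{E}[\tau_1^s]=\int_0^\infty x^s\,F(dx)<\infty$ for some $s\ge 2$. Let $z:[0,\infty)\to[0,\infty)$ be a measurable function that is integrable, bounded, and satisfies $z(x)=O(x^{-r})$ as $x\to\infty$ for some $r>1$. Then, for every $q$ with $0\le q\le s-1$, $$\Phi*z(x)=m\int_0^\infty z(y)\,dy+O\left(x^{\max\{1-r,-q\}}\right)\quad\text{as }x\to\infty.$$ Moreover, if $z(x)=o(x^{-r})$ as $x\to\infty$, then the same expansion holds with $o\left(x^{\max\{1-r,-q\}}\right)$ in place of $O\left(x^{\max\{1-r,-q\}}\right)$.
   Context: $\tau_1,\tau_2,\dots$ are i.i.d. random variables with values in $(0,\infty)$ and distribution function $F(x)=\mathbb{P}(\tau_1\le x)$, $x\ge 0$ (the interarrival distribution); $F$ also denotes the corresponding probability measure. The constant $m$ is defined by $m^{-1}:=\mathbb{E}[\tau_1]=\int_0^\infty xF(dx)$, assumed finite. $F$ is called spread out if for some $n\ge 1$ there exists a nonnegative measure $G\neq 0$ with $G\le F^{*n}$ such that $G$ is absolutely continuous with respect to Lebesgue measure. Here $F^{*n}$ is the $n$-fold convolution of $F$, with $F^{*0}=\delta_0$. The renewal measure is $\Phi=\sum_{n\ge 0}F^{*n}$ (a measure on $[0,\infty)$, including the atom at $0$ from $n=0$), and $\Phi*z(x)=\int_{[0,x]}z(x-u)\,\Phi(du)$ for $x\ge 0$. *)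

theory Defs
  imports "HOL-Probability.Probability" "HOL-Library.Landau_Symbols"
begin

primrec conv_power :: "real measure \<Rightarrow> nat \<Rightarrow> real measure" where
  "conv_power F 0 = return borel 0"
| "conv_power F (Suc n) = (F \<star> conv_power F n)"

definition spread_out :: "real measure \<Rightarrow> bool" where
  "spread_out F \<longleftrightarrow>
     (\<exists>n\<ge>1. \<exists>G. sets G = sets borel \<and> G \<noteq> null_measure borel \<and>
        (\<forall>A\<in>sets borel. emeasure G A \<le> emeasure (conv_power F n) A) \<and>
        absolutely_continuous lborel G)"

definition renewal_measure :: "real measure \<Rightarrow> real measure" where
  "renewal_measure F =
     measure_of UNIV (sets borel) (\<lambda>A. \<Sum>n. emeasure (conv_power F n) A)"

definition renewal_conv :: "real measure \<Rightarrow> (real \<Rightarrow> real) \<Rightarrow> real \<Rightarrow> real" where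
  "renewal_conv F z x = (LINT u:{0..x}|renewal_measure F. z (x - u))"

lemma sets_conv_power [simp]: "sets (conv_power F n) = sets borel"
  by (cases n) auto

lemma space_conv_power [simp]: "space (conv_power F n) = UNIV"
  by (cases n) auto

lemma sets_renewal_measure [simp, measurable_cong]: "sets (renewal_measure F) = sets borel"
  unfolding renewal_measure_def
  using sets.sigma_sets_eq[of "borel :: real measure"] by (simp add: sets_measure_of_conv)

lemma space_renewal_measure [simp]: "space (renewal_measure F) = UNIV"
  unfolding renewal_measure_def by (simp add: space_measure_of_conv)

(* measure_of yields the zero measure unless the set function it is given is countably
   additive, so this is the fact that makes renewal_measure the intended sum. *)
lemma emeasure_renewal_measure:
  assumes "A \<in> sets borel"
  shows "emeasure (renewal_measure F) A = (\<Sum>n. emeasure (conv_power F n) A)"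
proof (rule emeasure_measure_of[OF renewal_measure_def])
  show "countably_additive (sets (renewal_measure F)) (\<lambda>A. \<Sum>n. emeasure (conv_power F n) A)"
  proof (rule countably_additiveI)
    fix A :: "nat \<Rightarrow> real set"
    assume A: "range A \<subseteq> sets (renewal_measure F)" "disjoint_family A"
    have "(\<Sum>i. \<Sum>n. emeasure (conv_power F n) (A i))
        = (\<Sum>i. \<integral>\<^sup>+ n. emeasure (conv_power F n) (A i) \<partial>count_space UNIV)"
      by (simp add: nn_integral_count_space_nat)
    also have "\<dots> = (\<integral>\<^sup>+ n. (\<Sum>i. emeasure (conv_power F n) (A i)) \<partial>count_space UNIV)"
      by (rule nn_integral_suminf[symmetric]) simp
    also have "\<dots> = (\<Sum>n. \<Sum>i. emeasure (conv_power F n) (A i))"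
      by (simp add: nn_integral_count_space_nat)
    also have "\<dots> = (\<Sum>n. emeasure (conv_power F n) (\<Union>i. A i))"
      using A by (intro suminf_cong suminf_emeasure) auto
    finally show "(\<Sum>i. \<Sum>n. emeasure (conv_power F n) (A i))
        = (\<Sum>n. emeasure (conv_power F n) (\<Union>i. A i))" .
  qed
qed (use assms in \<open>auto simp: positive_def\<close>)

end

theory Submission
  imports Defs
begin

text \<open>
  Write \<open>\<Phi>\<close> for the renewal measure. Call a measurable function with values in \<open>[0, 1]\<close> that vanishes
  off \<open>[0, 1)\<close> a profile, and let \<open>U f x\<close> be the value at \<open>x\<close> of the convolution of \<open>f\<close> with \<open>\<Phi>\<close>. Cutting
  \<open>z\<close> into its pieces on the cells \<open>[k, k + 1)\<close> writes it as a sum of translated profiles with weights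
  \<open>c k = sup z\<close> over the cell. If \<open>\<bar>U f x - m * \<integral>f\<bar> \<le> W x\<close> holds for all profiles, with \<open>W\<close> decreasing and
  bounded, then the error in the theorem is at most \<open>\<Sum>k. c k * W (x - k)\<close>, hence at most \<open>W (x / 2)\<close>
  times the sum of \<open>c\<close>, plus a constant times the sum of \<open>c k\<close> over \<open>k \<ge> x / 2\<close>. The second term is
  \<open>O(x powr (1 - r))\<close>, with little-o when \<open>z\<close> decays with little-o. So the theorem follows from
  \<open>W x = o(x powr (1 - s))\<close>, a convergence rate in total variation on unit intervals.

  The rate is proved for the oscillation: the supremum \<open>W t\<close> of \<open>\<bar>U f x - U f y\<bar>\<close> over all profiles and all
  \<open>x, y \<ge> t\<close>. For a walk that moves downwards from \<open>x\<close>, the potential \<open>U f x\<close> is the average of \<open>U f (l - r)\<close>,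
  where \<open>r\<close> is the overshoot below a level \<open>l < x\<close> (\<open>potential_after_passage\<close>). Two properties of the
  overshoot laws are needed, both uniform in the starting point. Their tails beyond \<open>\<rho>\<close> are at most a
  constant times the integral of \<open>t\<close> over \<open>t > \<rho>\<close> with respect to \<open>F\<close>, which is \<open>o(\<rho> powr (1 - s))\<close>
  (\<open>overshoot_tail_le\<close>, \<open>overshoot_bound_rate\<close>). And once the distance \<open>x - l\<close> is at least
  some \<open>L\<close>, they dominate one common nonzero measure (\<open>overshoot_minorization\<close>); this is where \<open>F\<close> being spread out enters, through the fact that \<open>\<Phi>\<close>
  dominates a fixed multiple of Lebesgue measure far from the origin. As in Doeblin's argument for
  Markov chains this gives

  \<open>W t \<le> (1 - \<epsilon>) * W (t - L - A) + o(A powr (1 - s))\<close>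

  (\<open>oscillation_contraction\<close>). With \<open>A\<close> a small multiple of \<open>t\<close>, the inequality becomes a contraction under
  rescaling, \<open>W t \<le> (1 - \<epsilon>) * W (\<alpha> * t) + o(t powr (1 - s))\<close>, where \<open>\<alpha> < 1\<close> can be taken so close to \<open>1\<close> that
  \<open>1 - \<epsilon> < \<alpha> powr (s - 1)\<close>. Such an inequality forces \<open>W t = o(t powr (1 - s))\<close> (\<open>contraction_decay\<close>).

  In particular every \<open>U f\<close> converges. The limit is \<open>\<kappa> * \<integral>f\<close> for a constant \<open>\<kappa>\<close>, because two profiles can be
  averaged against each other symmetrically (\<open>potential_limit\<close>), and \<open>\<kappa> = m\<close> because the convolution of
  \<open>\<Phi>\<close> with the tail function of \<open>F\<close> is \<open>1\<close> (\<open>renewal_constant\<close>).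
\<close>

section \<open>Lebesgue minorants of measures\<close>

text \<open>Comparing two measures through their values on sets gives comparison of all integrals, because
  simple functions already compute the integral as a supremum.\<close>

lemma nn_integral_mono_measure:
  assumes "sets M = sets N"
    and le: "\<And>A. A \<in> sets M \<Longrightarrow> emeasure M A \<le> emeasure N A"
    and \<phi>: "\<phi> \<in> borel_measurable M"
  shows "(\<integral>\<^sup>+x. \<phi> x \<partial>M) \<le> (\<integral>\<^sup>+x. \<phi> x \<partial>N)"
proof -
  have sp: "space M = space N" using assms(1) by (rule sets_eq_imp_space_eq)
  have "simple_integral M g \<le> simple_integral N g" if "simple_function M g" for g :: "'a \<Rightarrow> ennreal"
    unfolding simple_integral_def sp[symmetric]
    using that by (intro sum_mono mult_left_mono le) (auto simp: simple_function_def)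
  moreover have "simple_function M g \<longleftrightarrow> simple_function N g" for g :: "'a \<Rightarrow> ennreal"
    by (simp add: simple_function_def sp assms(1))
  ultimately show ?thesis
    unfolding nn_integral_def by (intro SUP_mono) blast
qed

text \<open>A weak form of the Lebesgue density theorem. If \<open>A\<close> filled at most the fraction \<open>c\<close> of every
  interval, then, summing over the components of an open superset, it would fill at most the fraction
  \<open>c\<close> of every open \<open>U \<supseteq> A\<close>; this is absurd once the measure of \<open>U\<close> is below the measure of \<open>A\<close>
  divided by \<open>c\<close>.\<close>

lemma interval_of_high_density:
  fixes A :: "real set"
  assumes A: "A \<in> sets borel" and pos: "0 < emeasure lborel A" and fin: "emeasure lborel A < \<infinity>"
    and c: "0 < c" "c < 1"
  obtains a b where "a < b" "ennreal (c * (b - a)) < emeasure lborel (A \<inter> {a..b})"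
proof (rule ccontr)
  assume "\<not> thesis"
  then have neg: "emeasure lborel (A \<inter> {a..b}) \<le> ennreal (c * (b - a))" if "a < b" for a b
    using that \<open>\<And>b a. a < b \<Longrightarrow> ennreal (c * (b - a)) < emeasure lborel (A \<inter> {a..b}) \<Longrightarrow> thesis\<close>
    by (meson not_le)
  define \<alpha> where "\<alpha> = measure lborel A"
  have \<alpha>: "emeasure lborel A = ennreal \<alpha>" "0 < \<alpha>"
  proof -
    show "emeasure lborel A = ennreal \<alpha>" unfolding \<alpha>_def using fin by (intro emeasure_eq_ennreal_measure) auto
    with pos show "0 < \<alpha>" by (metis ennreal_less_zero_iff)
  qed
  have e: "0 < \<alpha> * (1 / c - 1)" using \<alpha> c by (simp add: field_simps)
  obtain U where U: "open U" "A \<subseteq> U" "emeasure lborel (U - A) < ennreal (\<alpha> * (1 / c - 1))"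
    using outer_regular_lborel[OF A e] by blast
  have [measurable]: "U \<in> sets borel" "A \<in> sets borel" using U A by auto
  have "emeasure lborel U = emeasure lborel A + emeasure lborel (U - A)"
    using U by (subst plus_emeasure) (auto simp: Un_absorb1)
  also have "\<dots> < ennreal \<alpha> + ennreal (\<alpha> * (1 / c - 1))"
    using U \<alpha> by (simp add: ennreal_add_left_cancel_less)
  also have "\<dots> = ennreal (\<alpha> / c)"
    using e \<alpha> c by (subst ennreal_plus[symmetric]) (auto simp: algebra_simps)
  finally have Ule: "emeasure lborel U < ennreal (\<alpha> / c)" .
  let ?I = "components U"
  have opC: "open C" if "C \<in> ?I" for C using U(1) that by (rule open_components)
  \<comment> \<open>The components of an open set are countably many disjoint open intervals.\<close>
  have disj: "disjoint_family_on (\<lambda>C. C) ?I"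
    using pairwise_disjoint_components[of U] by (auto simp: disjoint_family_on_def pairwise_def disjnt_def)
  have cnt: "countable ?I"
    using opC disj by (intro countable_disjoint_open_subsets) (auto simp: disjoint_def disjoint_family_on_def)
  have comp: "emeasure lborel (A \<inter> C) \<le> ennreal c * emeasure lborel C" if C: "C \<in> ?I" for C
  proof -
    have ne: "C \<noteq> {}" and conn: "connected C" and CU: "C \<subseteq> U"
      using C in_components_nonempty in_components_connected in_components_subset by blast+
    have [measurable]: "C \<in> sets borel" using opC[OF C] by auto
    have iv: "{x..y} \<subseteq> C" if "x \<in> C" "y \<in> C" for x y
      using conn that connected_contains_Icc by blast
    have len: "y - x \<le> \<alpha> / c" if "x \<in> C" "y \<in> C" "x \<le> y" for x y
    proof -
      have "ennreal (y - x) = emeasure lborel {x..y}" using that by simp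
      also have "\<dots> \<le> emeasure lborel U" using iv[OF that(1,2)] CU by (intro emeasure_mono) auto
      also have "\<dots> \<le> ennreal (\<alpha> / c)" using Ule by simp
      finally show ?thesis using \<alpha> c by (simp add: ennreal_le_iff)
    qed
    obtain x0 where x0: "x0 \<in> C" using ne by auto
    have bd: "\<bar>x - x0\<bar> \<le> \<alpha> / c" if "x \<in> C" for x
      using len[of x x0] len[of x0 x] that x0 by (cases "x \<le> x0") auto
    have bdd: "bdd_above C" "bdd_below C"
      using bd by (auto intro!: bdd_aboveI[of _ "x0 + \<alpha> / c"] bdd_belowI[of _ "x0 - \<alpha> / c"] simp: abs_le_iff)
         (smt (verit))+
    define a b where "a = Inf C" and "b = Sup C"
    have sub: "C \<subseteq> {a..b}" using bdd by (auto simp: a_def b_def cInf_lower cSup_upper)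
    have sup: "{a<..<b} \<subseteq> C"
    proof
      fix x assume x: "x \<in> {a<..<b}"
      then obtain y z where "y \<in> C" "y < x" "z \<in> C" "x < z"
        using bdd ne by (auto simp: a_def b_def cInf_less_iff less_cSup_iff)
      then show "x \<in> C" using iv[of y z] by auto
    qed
    have ab: "a < b"
    proof -
      obtain d where "d > 0" "ball x0 d \<subseteq> C" using opC[OF C] x0 open_contains_ball by blast
      then have "x0 + d / 2 \<in> C" by (auto simp: dist_real_def subset_eq)
      with sub x0 have "a \<le> x0" "x0 + d / 2 \<le> b" by auto
      with \<open>d > 0\<close> show ?thesis by simp
    qed
    have "emeasure lborel (A \<inter> C) \<le> emeasure lborel (A \<inter> {a..b})"
      using sub by (intro emeasure_mono) auto
    also have "\<dots> \<le> ennreal c * ennreal (b - a)" using neg[OF ab] ab c by (simp add: ennreal_mult)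
    also have "ennreal (b - a) = emeasure lborel {a<..<b}" using ab by simp
    also have "\<dots> \<le> emeasure lborel C" using sup by (intro emeasure_mono) auto
    finally show ?thesis by (simp add: mult_left_mono)
  qed
  have "emeasure lborel A = emeasure lborel (\<Union>C\<in>?I. A \<inter> C)"
    using U(2) Union_components[of U] by (intro arg_cong[where f = "emeasure lborel"]) auto
  also have "\<dots> = (\<integral>\<^sup>+C. emeasure lborel (A \<inter> C) \<partial>count_space ?I)"
    using opC cnt disj by (intro emeasure_UN_countable) (auto simp: disjoint_family_on_def)
  also have "\<dots> \<le> (\<integral>\<^sup>+C. ennreal c * emeasure lborel C \<partial>count_space ?I)"
    using comp by (intro nn_integral_mono) auto
  also have "\<dots> = ennreal c * (\<integral>\<^sup>+C. emeasure lborel C \<partial>count_space ?I)"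
    by (rule nn_integral_cmult) auto
  also have "(\<integral>\<^sup>+C. emeasure lborel C \<partial>count_space ?I) = emeasure lborel (\<Union>C\<in>?I. C)"
    using opC cnt disj by (intro emeasure_UN_countable[symmetric]) auto
  also have "(\<Union>C\<in>?I. C) = U" using Union_components[of U] by auto
  also have "ennreal c * emeasure lborel U < ennreal c * ennreal (\<alpha> / c)"
    using Ule c by (intro ennreal_mult_strict_left_mono) auto
  also have "\<dots> = emeasure lborel A" using \<alpha> c by (simp add: ennreal_mult[symmetric])
  finally show False by simp
qed

text \<open>This says that the measure with Lebesgue density \<open>k\<close> lies below \<open>\<mu>\<close>. It is phrased through
  integrals since that is the form in which convolutions are estimated.\<close>

definition density_minorant :: "(real \<Rightarrow> ennreal) \<Rightarrow> real measure \<Rightarrow> bool" where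
  "density_minorant k \<mu> \<longleftrightarrow> k \<in> borel_measurable borel \<and>
     (\<forall>\<phi>\<in>borel_measurable borel. (\<integral>\<^sup>+x. k x * \<phi> x \<partial>lborel) \<le> (\<integral>\<^sup>+x. \<phi> x \<partial>\<mu>))"

lemma density_minorantD:
  assumes "density_minorant k \<mu>" "\<phi> \<in> borel_measurable borel"
  shows "(\<integral>\<^sup>+x. k x * \<phi> x \<partial>lborel) \<le> (\<integral>\<^sup>+x. \<phi> x \<partial>\<mu>)"
  using assms by (auto simp: density_minorant_def)

lemma density_minorant_mono:
  assumes "density_minorant k \<mu>" "l \<in> borel_measurable borel" "\<And>x. l x \<le> k x"
  shows "density_minorant l \<mu>"
proof -
  have "(\<integral>\<^sup>+x. l x * \<phi> x \<partial>lborel) \<le> (\<integral>\<^sup>+x. k x * \<phi> x \<partial>lborel)" for \<phi> :: "real \<Rightarrow> ennreal"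
    using assms(3) by (intro nn_integral_mono mult_right_mono) auto
  then show ?thesis
    using assms(1,2) unfolding density_minorant_def by (blast intro: order_trans)
qed

text \<open>Convolution is monotone in both factors, so minorants may be convolved as densities.\<close>

lemma density_minorant_convolution:
  assumes k: "density_minorant k \<mu>" and l: "density_minorant l \<nu>"
    and fin: "finite_measure \<mu>" "finite_measure \<nu>"
    and sets [simp]: "sets \<mu> = sets borel" "sets \<nu> = sets borel"
  shows "density_minorant (\<lambda>x. \<integral>\<^sup>+u. k u * l (x - u) \<partial>lborel) (\<mu> \<star> \<nu>)"
  unfolding density_minorant_def
proof (intro conjI ballI)
  interpret \<nu>: finite_measure \<nu> by fact
  have [measurable]: "k \<in> borel_measurable borel" "l \<in> borel_measurable borel"
    using k l by (auto simp: density_minorant_def)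
  have [measurable_cong]: "sets \<mu> = sets borel" "sets \<nu> = sets borel" by simp_all
  show "(\<lambda>x. \<integral>\<^sup>+ u. k u * l (x - u) \<partial>lborel) \<in> borel_measurable borel" by measurable
  fix \<phi> :: "real \<Rightarrow> ennreal" assume [measurable]: "\<phi> \<in> borel_measurable borel"
  have "(\<integral>\<^sup>+x. (\<integral>\<^sup>+u. k u * l (x - u) \<partial>lborel) * \<phi> x \<partial>lborel)
      = (\<integral>\<^sup>+x. \<integral>\<^sup>+u. k u * l (x - u) * \<phi> x \<partial>lborel \<partial>lborel)"
    by (intro nn_integral_cong nn_integral_multc[symmetric]) measurable
  also have "\<dots> = (\<integral>\<^sup>+u. \<integral>\<^sup>+x. k u * l (x - u) * \<phi> x \<partial>lborel \<partial>lborel)"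
    by (rule lborel_pair.Fubini'[symmetric]) measurable
  also have "\<dots> = (\<integral>\<^sup>+u. k u * (\<integral>\<^sup>+v. l v * \<phi> (u + v) \<partial>lborel) \<partial>lborel)"
  proof (rule nn_integral_cong)
    fix u
    have "(\<integral>\<^sup>+x. k u * l (x - u) * \<phi> x \<partial>lborel) = (\<integral>\<^sup>+v. k u * l v * \<phi> (u + v) \<partial>lborel)"
      by (subst nn_integral_real_affine[where c = 1 and t = u]) auto
    also have "\<dots> = k u * (\<integral>\<^sup>+v. l v * \<phi> (u + v) \<partial>lborel)"
      by (subst nn_integral_cmult[symmetric]) (auto simp: mult.assoc)
    finally show "(\<integral>\<^sup>+x. k u * l (x - u) * \<phi> x \<partial>lborel) = k u * (\<integral>\<^sup>+v. l v * \<phi> (u + v) \<partial>lborel)" .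
  qed
  also have "\<dots> \<le> (\<integral>\<^sup>+u. k u * (\<integral>\<^sup>+v. \<phi> (u + v) \<partial>\<nu>) \<partial>lborel)"
    by (intro nn_integral_mono mult_left_mono density_minorantD[OF l]) auto
  also have "\<dots> \<le> (\<integral>\<^sup>+u. \<integral>\<^sup>+v. \<phi> (u + v) \<partial>\<nu> \<partial>\<mu>)"
    by (rule density_minorantD[OF k]) measurable
  also have "\<dots> = (\<integral>\<^sup>+x. \<phi> x \<partial>(\<mu> \<star> \<nu>))"
    using fin by (intro nn_integral_convolution[symmetric]) auto
  finally show "(\<integral>\<^sup>+x. (\<integral>\<^sup>+u. k u * l (x - u) \<partial>lborel) * \<phi> x \<partial>lborel) \<le> (\<integral>\<^sup>+x. \<phi> x \<partial>(\<mu> \<star> \<nu>))" .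
qed

text \<open>Convolving a set of positive measure with itself produces a density that is bounded below on an
  interval. If \<open>A\<close> fills more than \<open>7/8\<close> of \<open>[a, b]\<close> and \<open>x\<close> is within a quarter length of
  \<open>a + b\<close>, then \<open>A \<inter> [a, b]\<close> and its reflection \<open>x - (A \<inter> [a, b])\<close> both live in an interval of
  length \<open>5/4 * (b - a)\<close>, so they overlap in measure at least \<open>(2 * 7/8 - 5/4) * (b - a)\<close>.\<close>

lemma indicator_convolution_ge:
  fixes A :: "real set"
  assumes [measurable]: "A \<in> sets borel" and ab: "a < b"
    and dens: "ennreal (7/8 * (b - a)) < emeasure lborel (A \<inter> {a..b})"
    and x: "x \<in> {2*a + 3/4*(b-a)..2*a + 5/4*(b-a)}"
  shows "ennreal ((b - a) / 2) \<le> (\<integral>\<^sup>+u. indicator A u * indicator A (x - u) \<partial>lborel)"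
proof -
  define w where "w = b - a"
  define B where "B = A \<inter> {a..b}"
  define B' where "B' = (\<lambda>u. x - u) -` B"
  have [measurable]: "B \<in> sets borel" "B' \<in> sets borel"
    unfolding B_def B'_def by (auto intro!: measurable_sets_borel[where M = borel])
  have eB: "emeasure lborel B' = emeasure lborel B"
  proof -
    have "emeasure lborel B = (\<integral>\<^sup>+u. indicator B u \<partial>lborel)" by simp
    also have "\<dots> = (\<integral>\<^sup>+u. indicator B (x - u) \<partial>lborel)"
      by (subst nn_integral_real_affine[where c = "-1" and t = x]) auto
    also have "\<dots> = (\<integral>\<^sup>+u. indicator B' u \<partial>lborel)"
      by (intro nn_integral_cong) (auto simp: B'_def indicator_def)
    finally show ?thesis by simp
  qed
  have finB: "emeasure lborel B < \<infinity>"
    using emeasure_mono[of B "{a..b}" lborel] ab by (auto simp: B_def less_top[symmetric] top_unique)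
  define \<beta> where "\<beta> = measure lborel B"
  have \<beta>: "emeasure lborel B = ennreal \<beta>" using finB by (simp add: \<beta>_def emeasure_eq_ennreal_measure)
  have \<beta>w: "7/8 * w < \<beta>"
    using dens \<beta> ab by (auto simp: B_def[symmetric] w_def ennreal_less_iff)
  have un: "emeasure lborel (B \<union> B') \<le> ennreal (5/4 * w)"
  proof -
    have "B \<union> B' \<subseteq> {min a (x - b)..max b (x - a)}" by (auto simp: B_def B'_def)
    then have "emeasure lborel (B \<union> B') \<le> emeasure lborel {min a (x - b)..max b (x - a)}"
      by (intro emeasure_mono) auto
    also have "\<dots> = ennreal (max b (x - a) - min a (x - b))" using ab by simp
    also have "\<dots> \<le> ennreal (5/4 * w)" proof (rule ennreal_leI)
      show "max b (x - a) - min a (x - b) \<le> 5/4 * w"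
        using x ab by (cases "b \<le> x - a"; cases "a \<le> x - b"; simp add: w_def field_simps)
    qed
    finally show ?thesis .
  qed
  have "ennreal (2 * \<beta>) = emeasure lborel B + emeasure lborel B'"
    using \<beta>w ab by (simp add: eB \<beta> w_def ennreal_plus[symmetric] del: ennreal_plus)
  also have "\<dots> = emeasure lborel (B \<union> B') + emeasure lborel (B \<inter> B')"
    by (rule emeasure_Un_Int) auto
  also have "\<dots> \<le> ennreal (5/4 * w) + emeasure lborel (B \<inter> B')"
    using un by (rule add_right_mono)
  finally have le: "ennreal (2 * \<beta>) \<le> ennreal (5/4 * w) + emeasure lborel (B \<inter> B')" .
  have "ennreal (w / 2) \<le> emeasure lborel (B \<inter> B')"
  proof -
    have "ennreal (5/4 * w) + ennreal (w / 2) \<le> ennreal (2 * \<beta>)"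
      using \<beta>w ab by (subst ennreal_plus[symmetric]) (auto simp: w_def field_simps simp del: ennreal_plus intro!: ennreal_leI)
    with le have "ennreal (5/4 * w) + ennreal (w / 2) \<le> ennreal (5/4 * w) + emeasure lborel (B \<inter> B')"
      by (rule order_trans[rotated])
    then show ?thesis by (simp add: ennreal_add_left_cancel_le)
  qed
  also have "emeasure lborel (B \<inter> B') = (\<integral>\<^sup>+u. indicator (B \<inter> B') u \<partial>lborel)" by simp
  also have "\<dots> \<le> (\<integral>\<^sup>+u. indicator A u * indicator A (x - u) \<partial>lborel)"
    by (intro nn_integral_mono) (auto simp: B_def B'_def indicator_def)
  finally show ?thesis by (simp add: w_def)
qed

section \<open>The renewal measure of a positive law\<close>

locale renewal_law =
  fixes F :: "real measure"
  assumes prob_F: "prob_space F"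
    and sets_F [simp, measurable_cong]: "sets F = sets borel"
    and pos_F: "AE t in F. 0 < t"
begin

sublocale F: prob_space F by (rule prob_F)

lemma space_F [simp]: "space F = UNIV"
  using sets_eq_imp_space_eq[OF sets_F] by simp

lemma measurable_conv_power [measurable_cong]: "sets (conv_power F n) = sets borel"
  by simp

lemma prob_space_conv_power: "prob_space (conv_power F n)"
proof (induction n)
  case (Suc n)
  then show ?case
    unfolding conv_power.simps convolution_def
    by (intro prob_space.prob_space_distr prob_space_pair prob_F) measurable
qed (auto intro: prob_space_return)

lemma finite_measure_conv_power: "finite_measure (conv_power F n)"
  using prob_space_conv_power prob_space.finite_measure by blast

lemma conv_power_add: "conv_power F (i + j) = (conv_power F i \<star> conv_power F j)"
proof (induction i)
  case 0
  interpret J: prob_space "conv_power F j" by (rule prob_space_conv_power)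
  have "((return borel 0 :: real measure) \<star> conv_power F j) = conv_power F j"
  proof (rule measure_eqI)
    fix A :: "real set" assume "A \<in> sets ((return borel 0 :: real measure) \<star> conv_power F j)"
    then show "emeasure (return borel 0 \<star> conv_power F j) A = emeasure (conv_power F j) A"
      by (subst convolution_emeasure)
         (auto simp: prob_space_return prob_space.finite_measure J.finite_measure_axioms nn_integral_return)
  qed simp
  then show ?case by simp
next
  case (Suc i)
  then show ?case
    by (simp add: convolution_associative finite_measure_conv_power F.finite_measure_axioms)
qed

lemma nn_integral_conv_power_Suc:
  assumes [measurable]: "\<phi> \<in> borel_measurable borel"
  shows "(\<integral>\<^sup>+x. \<phi> x \<partial>conv_power F (Suc n)) = (\<integral>\<^sup>+t. \<integral>\<^sup>+v. \<phi> (t + v) \<partial>conv_power F n \<partial>F)"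
  unfolding conv_power.simps
  by (intro nn_integral_convolution F.finite_measure_axioms finite_measure_conv_power) auto

lemma AE_conv_power_nonneg: "AE v in conv_power F n. 0 \<le> v"
proof (induction n)
  case 0
  show ?case unfolding conv_power.simps by (subst AE_return) auto
next
  case (Suc n)
  interpret N: prob_space "conv_power F n" by (rule prob_space_conv_power)
  have "(\<integral>\<^sup>+x. indicator {..<0} x \<partial>conv_power F (Suc n))
      = (\<integral>\<^sup>+t. \<integral>\<^sup>+v. indicator {..<0} (t + v) \<partial>conv_power F n \<partial>F)"
    by (rule nn_integral_conv_power_Suc) auto
  also have "\<dots> = (\<integral>\<^sup>+t. 0 \<partial>F)"
  proof (intro nn_integral_cong_AE, use pos_F in eventually_elim)
    fix t :: real assume "0 < t"
    then have "(\<integral>\<^sup>+v. indicator {..<0} (t + v) \<partial>conv_power F n) = (\<integral>\<^sup>+v. 0 \<partial>conv_power F n)"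
      using Suc by (intro nn_integral_cong_AE) (auto elim!: eventually_mono simp: indicator_def)
    then show "(\<integral>\<^sup>+v. indicator {..<0} (t + v) \<partial>conv_power F n) = 0" by simp
  qed
  finally have "emeasure (conv_power F (Suc n)) {..<0} = 0"
    by (subst (asm) nn_integral_indicator) auto
  then show ?case
    by (intro AE_I[of _ _ "{..<0}"]) (auto simp del: conv_power.simps)
qed

abbreviation "\<Phi> \<equiv> renewal_measure F"

lemma nn_integral_renewal_measure:
  assumes "\<phi> \<in> borel_measurable borel"
  shows "(\<integral>\<^sup>+x. \<phi> x \<partial>\<Phi>) = (\<Sum>n. \<integral>\<^sup>+x. \<phi> x \<partial>conv_power F n)"
  using assms
proof (induction rule: borel_measurable_induct)
  case (cong f g)
  then show ?case by (simp cong: nn_integral_cong)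
next
  case (set A)
  then show ?case by (simp add: emeasure_renewal_measure)
next
  case (mult u c)
  then show ?case by (simp add: nn_integral_cmult)
next
  case (add u v)
  then show ?case by (simp add: nn_integral_add suminf_add[symmetric])
next
  case (seq U)
  have [measurable]: "U i \<in> borel_measurable borel" for i by (rule seq(1))
  have "(\<integral>\<^sup>+x. (SUP i. U i) x \<partial>\<Phi>) = (SUP i. \<integral>\<^sup>+x. U i x \<partial>\<Phi>)"
    unfolding SUP_apply using seq by (intro nn_integral_monotone_convergence_SUP) auto
  also have "\<dots> = (SUP i. \<integral>\<^sup>+n. \<integral>\<^sup>+x. U i x \<partial>conv_power F n \<partial>count_space UNIV)"
    using seq by (simp add: nn_integral_count_space_nat)
  also have "\<dots> = (\<integral>\<^sup>+n. (SUP i. \<integral>\<^sup>+x. U i x \<partial>conv_power F n) \<partial>count_space UNIV)"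
    using seq by (intro nn_integral_monotone_convergence_SUP[symmetric])
      (auto simp: incseq_def le_fun_def intro!: nn_integral_mono)
  also have "\<dots> = (\<integral>\<^sup>+n. \<integral>\<^sup>+x. (SUP i. U i) x \<partial>conv_power F n \<partial>count_space UNIV)"
    unfolding SUP_apply using seq
    by (intro nn_integral_cong nn_integral_monotone_convergence_SUP[symmetric]) auto
  finally show ?case by (simp add: nn_integral_count_space_nat)
qed

lemma AE_renewal_nonneg: "AE v in \<Phi>. 0 \<le> v"
proof (rule AE_I[of _ _ "{..<0}"])
  have "emeasure (conv_power F n) {..<0} = 0" for n
    using AE_conv_power_nonneg[of n] by (subst (asm) AE_iff_measurable[of "{..<0}"]) auto
  then show "emeasure \<Phi> {..<0} = 0" by (simp add: emeasure_renewal_measure)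
qed auto

lemma density_minorant_renewal:
  assumes "density_minorant k (conv_power F n)"
  shows "density_minorant k \<Phi>"
proof -
  have "(\<integral>\<^sup>+x. \<phi> x \<partial>conv_power F n) \<le> (\<integral>\<^sup>+x. \<phi> x \<partial>\<Phi>)"
    if "\<phi> \<in> borel_measurable borel" for \<phi> :: "real \<Rightarrow> ennreal"
  proof -
    have "(\<Sum>i\<in>{n}. \<integral>\<^sup>+x. \<phi> x \<partial>conv_power F i) \<le> (\<Sum>i. \<integral>\<^sup>+x. \<phi> x \<partial>conv_power F i)"
      by (rule sum_le_suminf) auto
    then show ?thesis by (simp add: nn_integral_renewal_measure[OF that])
  qed
  then show ?thesis using assms unfolding density_minorant_def by (meson order_trans)
qed

definition laplace_at_1 :: real where "laplace_at_1 = (\<integral>t. exp (- t) \<partial>F)"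

lemma laplace_at_1: "(\<integral>\<^sup>+t. ennreal (exp (- t)) \<partial>F) = ennreal laplace_at_1" "0 \<le> laplace_at_1" "laplace_at_1 < 1"
proof -
  have int: "integrable F (\<lambda>t. exp (- t))"
    using pos_F by (intro F.integrable_const_bound[where B = 1]) (auto elim!: eventually_mono)
  then show "(\<integral>\<^sup>+t. ennreal (exp (- t)) \<partial>F) = ennreal laplace_at_1"
    unfolding laplace_at_1_def by (intro nn_integral_eq_integral) auto
  show "0 \<le> laplace_at_1" unfolding laplace_at_1_def by simp
  have "(\<integral>t. exp (- t) \<partial>F) < (\<integral>t. 1 \<partial>F)"
    using pos_F by (intro F.integral_less_AE_space int) (auto elim!: eventually_mono simp: F.emeasure_space_1 space_F[symmetric] simp del: space_F)
  then show "laplace_at_1 < 1" using F.prob_space by (simp add: laplace_at_1_def)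
qed

text \<open>The Laplace transform at \<open>1\<close> is multiplicative under convolution and smaller than \<open>1\<close> for a positive
  law, so the mass that the \<open>n\<close>-fold convolution leaves on a bounded set decays geometrically. This
  makes the renewal measure locally finite.\<close>

lemma conv_power_laplace: "(\<integral>\<^sup>+v. ennreal (exp (- v)) \<partial>conv_power F n) = ennreal laplace_at_1 ^ n"
proof (induction n)
  case 0
  then show ?case by (simp add: nn_integral_return)
next
  case (Suc n)
  have "(\<integral>\<^sup>+v. ennreal (exp (- v)) \<partial>conv_power F (Suc n))
     = (\<integral>\<^sup>+t. \<integral>\<^sup>+v. ennreal (exp (- t)) * ennreal (exp (- v)) \<partial>conv_power F n \<partial>F)"
    by (subst nn_integral_conv_power_Suc) (auto simp: exp_add[symmetric] ennreal_mult[symmetric])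
  also have "\<dots> = (\<integral>\<^sup>+t. ennreal (exp (- t)) * ennreal laplace_at_1 ^ n \<partial>F)"
    by (subst nn_integral_cmult) (auto simp: Suc)
  also have "\<dots> = ennreal laplace_at_1 ^ Suc n"
    by (subst nn_integral_multc) (auto simp: laplace_at_1)
  finally show ?case .
qed

lemma conv_power_atMost_le: "emeasure (conv_power F n) {..g} \<le> ennreal (exp g * laplace_at_1 ^ n)"
proof -
  have "emeasure (conv_power F n) {..g} = (\<integral>\<^sup>+v. indicator {..g} v \<partial>conv_power F n)" by simp
  also have "\<dots> \<le> (\<integral>\<^sup>+v. ennreal (exp g) * ennreal (exp (- v)) \<partial>conv_power F n)"
    by (intro nn_integral_mono) (auto simp: indicator_def ennreal_mult[symmetric] exp_add[symmetric])
  also have "\<dots> = ennreal (exp g) * ennreal laplace_at_1 ^ n"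
    by (subst nn_integral_cmult) (auto simp: conv_power_laplace)
  finally show ?thesis using laplace_at_1(2) by (simp add: ennreal_mult ennreal_power)
qed

lemma emeasure_renewal_atMost: "emeasure \<Phi> {..g} < \<infinity>"
proof -
  have "emeasure \<Phi> {..g} \<le> (\<Sum>n. ennreal (exp g * laplace_at_1 ^ n))"
    by (subst emeasure_renewal_measure) (auto intro!: suminf_le conv_power_atMost_le)
  also have "\<dots> = ennreal (\<Sum>n. exp g * laplace_at_1 ^ n)"
    using laplace_at_1 by (intro suminf_ennreal2) (auto intro!: summable_mult summable_geometric)
  finally show ?thesis by (rule order_le_less_trans) simp
qed

sublocale \<Phi>: sigma_finite_measure \<Phi>
proof
  show "\<exists>A. countable A \<and> A \<subseteq> sets \<Phi> \<and> \<Union> A = space \<Phi> \<and> (\<forall>a\<in>A. emeasure \<Phi> a \<noteq> \<infinity>)"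
    using emeasure_renewal_atMost
    by (intro exI[of _ "range (\<lambda>n::nat. {..real n})"]) (auto simp: real_arch_simple less_top)
qed

text \<open>Uniqueness for the renewal equation, in the form of a walk that moves upwards from \<open>0\<close> and is killed
  above \<open>g\<close>. Substituting the equation into itself \<open>n\<close> times yields the partial sums of the integral
  of \<open>b\<close> plus a remainder, which is at most \<open>C\<close> times the probability that the walk is still in
  \<open>[0, g]\<close> after \<open>n\<close> steps.\<close>

lemma renewal_iteration:
  fixes Y b :: "real \<Rightarrow> ennreal"
  assumes [measurable]: "Y \<in> borel_measurable borel" "b \<in> borel_measurable borel"
    and eq: "\<And>p. 0 \<le> p \<Longrightarrow> Y p = b p + (\<integral>\<^sup>+t. Y (p + t) \<partial>F)"
    and zero: "\<And>p. g < p \<Longrightarrow> Y p = 0"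
    and bound: "\<And>p. 0 \<le> p \<Longrightarrow> p \<le> g \<Longrightarrow> Y p \<le> ennreal C"
  shows "Y 0 = (\<integral>\<^sup>+u. b u \<partial>\<Phi>)"
proof -
  have step: "(\<integral>\<^sup>+v. Y v \<partial>conv_power F n)
      = (\<integral>\<^sup>+v. b v \<partial>conv_power F n) + (\<integral>\<^sup>+v. Y v \<partial>conv_power F (Suc n))" for n
  proof -
    interpret N: prob_space "conv_power F n" by (rule prob_space_conv_power)
    interpret P: pair_sigma_finite F "conv_power F n" ..
    have "(\<integral>\<^sup>+v. Y v \<partial>conv_power F n)
        = (\<integral>\<^sup>+v. (b v + (\<integral>\<^sup>+t. Y (v + t) \<partial>F)) \<partial>conv_power F n)"
      by (intro nn_integral_cong_AE, use AE_conv_power_nonneg in eventually_elim) (rule eq)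
    also have "\<dots> = (\<integral>\<^sup>+v. b v \<partial>conv_power F n) + (\<integral>\<^sup>+v. \<integral>\<^sup>+t. Y (v + t) \<partial>F \<partial>conv_power F n)"
      by (rule nn_integral_add) measurable
    also have "(\<integral>\<^sup>+v. \<integral>\<^sup>+t. Y (v + t) \<partial>F \<partial>conv_power F n)
        = (\<integral>\<^sup>+t. \<integral>\<^sup>+v. Y (v + t) \<partial>conv_power F n \<partial>F)"
      by (rule P.Fubini') measurable
    also have "\<dots> = (\<integral>\<^sup>+v. Y v \<partial>conv_power F (Suc n))"
      by (subst nn_integral_conv_power_Suc) (auto simp: add.commute)
    finally show ?thesis .
  qed
  have sum: "Y 0 = (\<Sum>i<n. \<integral>\<^sup>+v. b v \<partial>conv_power F i) + (\<integral>\<^sup>+v. Y v \<partial>conv_power F n)" for n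
  proof (induction n)
    case 0
    show ?case by (simp add: nn_integral_return)
  next
    case (Suc n)
    then show ?case by (subst (asm) step) (simp add: add.assoc del: conv_power.simps)
  qed
  have rest: "(\<integral>\<^sup>+v. Y v \<partial>conv_power F n) \<le> ennreal \<bar>C\<bar> * ennreal (exp g * laplace_at_1 ^ n)" for n
  proof -
    have "(\<integral>\<^sup>+v. Y v \<partial>conv_power F n) \<le> (\<integral>\<^sup>+v. ennreal \<bar>C\<bar> * indicator {..g} v \<partial>conv_power F n)"
      using AE_conv_power_nonneg
    proof (intro nn_integral_mono_AE, eventually_elim)
      fix v :: real assume "0 \<le> v"
      then show "Y v \<le> ennreal \<bar>C\<bar> * indicator {..g} v"
        using zero[of v] bound[of v] by (auto simp: indicator_def not_le intro: order_trans ennreal_leI)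
    qed
    also have "\<dots> = ennreal \<bar>C\<bar> * emeasure (conv_power F n) {..g}"
      by (subst nn_integral_cmult_indicator) auto
    also have "\<dots> \<le> ennreal \<bar>C\<bar> * ennreal (exp g * laplace_at_1 ^ n)"
      by (intro mult_left_mono conv_power_atMost_le) auto
    finally show ?thesis .
  qed
  have "(\<lambda>n. ennreal (\<bar>C\<bar> * (exp g * laplace_at_1 ^ n))) \<longlonglongrightarrow> ennreal (\<bar>C\<bar> * (exp g * 0))"
    using laplace_at_1 by (intro tendsto_ennrealI tendsto_intros LIMSEQ_power_zero) auto
  then have "(\<lambda>n. ennreal \<bar>C\<bar> * ennreal (exp g * laplace_at_1 ^ n)) \<longlonglongrightarrow> 0"
    using laplace_at_1(2) by (simp add: ennreal_mult)
  then have "(\<lambda>n. \<integral>\<^sup>+v. Y v \<partial>conv_power F n) \<longlonglongrightarrow> 0"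
    by (rule tendsto_sandwich[OF _ _ tendsto_const, rotated 2]) (simp_all only: rest zero_le always_eventually simp_thms)
  moreover have "(\<lambda>n. \<Sum>i<n. \<integral>\<^sup>+v. b v \<partial>conv_power F i) \<longlonglongrightarrow> (\<integral>\<^sup>+u. b u \<partial>\<Phi>)"
    by (subst nn_integral_renewal_measure, measurable) (rule summable_LIMSEQ, simp)
  ultimately have "(\<lambda>n. (\<Sum>i<n. \<integral>\<^sup>+v. b v \<partial>conv_power F i) + (\<integral>\<^sup>+v. Y v \<partial>conv_power F n))
      \<longlonglongrightarrow> (\<integral>\<^sup>+u. b u \<partial>\<Phi>) + 0"
    by (intro tendsto_add)
  then have "(\<lambda>n. Y 0) \<longlonglongrightarrow> (\<integral>\<^sup>+u. b u \<partial>\<Phi>)" by (simp add: sum[symmetric])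
  then show ?thesis by (rule LIMSEQ_unique[OF tendsto_const])
qed

text \<open>Splitting off the zeroth convolution power and the first step: \<open>\<Phi> = \<delta>\<^sub>0 + F \<star> \<Phi>\<close>.\<close>

lemma renewal_equation:
  assumes [measurable]: "\<phi> \<in> borel_measurable borel"
  shows "(\<integral>\<^sup>+v. \<phi> (p + v) \<partial>\<Phi>) = \<phi> p + (\<integral>\<^sup>+t. \<integral>\<^sup>+v. \<phi> (p + t + v) \<partial>\<Phi> \<partial>F)"
proof -
  have "(\<integral>\<^sup>+t. \<integral>\<^sup>+v. \<phi> (p + t + v) \<partial>\<Phi> \<partial>F)
      = (\<integral>\<^sup>+t. (\<Sum>n. \<integral>\<^sup>+v. \<phi> (p + t + v) \<partial>conv_power F n) \<partial>F)"
    by (subst nn_integral_renewal_measure) auto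
  also have "\<dots> = (\<Sum>n. \<integral>\<^sup>+t. \<integral>\<^sup>+v. \<phi> (p + t + v) \<partial>conv_power F n \<partial>F)"
  proof (rule nn_integral_suminf)
    fix n
    interpret N: prob_space "conv_power F n" by (rule prob_space_conv_power)
    show "(\<lambda>t. \<integral>\<^sup>+v. \<phi> (p + t + v) \<partial>conv_power F n) \<in> borel_measurable F" by measurable
  qed
  also have "\<dots> = (\<Sum>n. \<integral>\<^sup>+v. \<phi> (p + v) \<partial>conv_power F (Suc n))"
    by (subst nn_integral_conv_power_Suc) (auto simp: add.assoc)
  finally have "\<phi> p + (\<integral>\<^sup>+t. \<integral>\<^sup>+v. \<phi> (p + t + v) \<partial>\<Phi> \<partial>F)
      = (\<Sum>n<1. \<integral>\<^sup>+v. \<phi> (p + v) \<partial>conv_power F n) + (\<Sum>n. \<integral>\<^sup>+v. \<phi> (p + v) \<partial>conv_power F (n + 1))"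
    by (simp add: nn_integral_return del: conv_power.simps(2))
  also have "\<dots> = (\<Sum>n. \<integral>\<^sup>+v. \<phi> (p + v) \<partial>conv_power F n)"
    by (subst add.commute, intro suminf_offset[symmetric]) auto
  finally show ?thesis by (subst nn_integral_renewal_measure) auto
qed

end

section \<open>First passage and overshoot\<close>

context renewal_law begin

text \<open>The law of \<open>S\<^sub>n - g\<close>, where \<open>S\<^sub>n\<close> is the first partial sum exceeding \<open>g\<close>. Since \<open>\<Phi>\<close> is the
  expected number of visits, decomposing at the last partial sum \<open>u \<le> g\<close> writes this law in terms of
  \<open>\<Phi>\<close> and one further step \<open>t\<close>; no probability space carrying the walk is needed.\<close>

definition overshoot :: "real \<Rightarrow> real measure" where
  "overshoot g = distr (density (\<Phi> \<Otimes>\<^sub>M F) (\<lambda>(u, t). indicator {..g} u * indicator {g<..} (u + t)))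
     borel (\<lambda>(u, t). u + t - g)"

lemma sets_overshoot [simp, measurable_cong]: "sets (overshoot g) = sets borel"
  by (simp add: overshoot_def)

lemma space_overshoot [simp]: "space (overshoot g) = UNIV"
  by (simp add: overshoot_def)

lemma nn_integral_overshoot:
  assumes [measurable]: "\<phi> \<in> borel_measurable borel"
  shows "(\<integral>\<^sup>+r. \<phi> r \<partial>overshoot g)
    = (\<integral>\<^sup>+u. indicator {..g} u * (\<integral>\<^sup>+t. indicator {g<..} (u + t) * \<phi> (u + t - g) \<partial>F) \<partial>\<Phi>)"
proof -
  have "(\<integral>\<^sup>+r. \<phi> r \<partial>overshoot g)
      = (\<integral>\<^sup>+x. (case x of (u, t) \<Rightarrow> indicator {..g} u * indicator {g<..} (u + t)) * \<phi> (case x of (u, t) \<Rightarrow> u + t - g) \<partial>(\<Phi> \<Otimes>\<^sub>M F))"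
    unfolding overshoot_def by (subst nn_integral_distr, measurable) (subst nn_integral_density, auto)
  also have "\<dots> = (\<integral>\<^sup>+u. \<integral>\<^sup>+t. indicator {..g} u * indicator {g<..} (u + t) * \<phi> (u + t - g) \<partial>F \<partial>\<Phi>)"
    by (subst F.nn_integral_fst[symmetric]) auto
  also have "\<dots> = (\<integral>\<^sup>+u. indicator {..g} u * (\<integral>\<^sup>+t. indicator {g<..} (u + t) * \<phi> (u + t - g) \<partial>F) \<partial>\<Phi>)"
    by (subst nn_integral_cmult[symmetric]) (auto simp: mult.assoc)
  finally show ?thesis .
qed

text \<open>Optional stopping at the first passage above \<open>g\<close>: the truncation of \<open>Y\<close> to \<open>{..g}\<close> solves a renewal
  equation whose source term is the contribution of the step that jumps over \<open>g\<close>.\<close>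

lemma first_passage:
  fixes Y :: "real \<Rightarrow> ennreal"
  assumes [measurable]: "Y \<in> borel_measurable borel" and g: "0 \<le> g"
    and harm: "\<And>p. 0 \<le> p \<Longrightarrow> p \<le> g \<Longrightarrow> Y p = (\<integral>\<^sup>+t. Y (p + t) \<partial>F)"
    and bound: "\<And>p. 0 \<le> p \<Longrightarrow> p \<le> g \<Longrightarrow> Y p \<le> ennreal C"
  shows "Y 0 = (\<integral>\<^sup>+r. Y (g + r) \<partial>overshoot g)"
proof -
  define Y' where "Y' p = indicator {..g} p * Y p" for p
  define b where "b p = indicator {..g} p * (\<integral>\<^sup>+t. indicator {g<..} (p + t) * Y (p + t) \<partial>F)" for p
  have [measurable]: "Y' \<in> borel_measurable borel" "b \<in> borel_measurable borel"
    unfolding Y'_def b_def by measurable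
  have "Y' 0 = (\<integral>\<^sup>+u. b u \<partial>\<Phi>)"
  proof (rule renewal_iteration[where g = g and C = C])
    fix p :: real assume p: "0 \<le> p"
    show "Y' p = b p + (\<integral>\<^sup>+t. Y' (p + t) \<partial>F)"
    proof (cases "p \<le> g")
      case True
      have "Y' p = (\<integral>\<^sup>+t. Y (p + t) \<partial>F)" using True harm[OF p] by (simp add: Y'_def)
      also have "\<dots> = (\<integral>\<^sup>+t. indicator {g<..} (p + t) * Y (p + t) + Y' (p + t) \<partial>F)"
        by (intro nn_integral_cong) (auto simp: Y'_def indicator_def)
      also have "\<dots> = (\<integral>\<^sup>+t. indicator {g<..} (p + t) * Y (p + t) \<partial>F) + (\<integral>\<^sup>+t. Y' (p + t) \<partial>F)"
        by (rule nn_integral_add) measurable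
      finally show ?thesis using True by (simp add: b_def)
    next
      case False
      have "(\<integral>\<^sup>+t. Y' (p + t) \<partial>F) = (\<integral>\<^sup>+t. 0 \<partial>F)"
        by (intro nn_integral_cong_AE, use pos_F in eventually_elim) (use False in \<open>auto simp: Y'_def indicator_def\<close>)
      then show ?thesis using False by (simp add: b_def Y'_def)
    qed
    show "Y' p \<le> ennreal C" if "p \<le> g"
      using bound[OF p that] that by (simp add: Y'_def)
  qed (auto simp: Y'_def)
  also have "(\<integral>\<^sup>+u. b u \<partial>\<Phi>) = (\<integral>\<^sup>+r. Y (g + r) \<partial>overshoot g)"
    by (subst nn_integral_overshoot, measurable) (simp add: b_def[abs_def] algebra_simps)
  finally show ?thesis using g by (simp add: Y'_def)
qed

lemma prob_space_overshoot:
  assumes "0 \<le> g"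
  shows "prob_space (overshoot g)"
proof
  have "(1::ennreal) = (\<integral>\<^sup>+r. 1 \<partial>overshoot g)"
    using assms by (intro first_passage[where C = 1 and Y = "\<lambda>_. 1"]) (auto simp: F.emeasure_space_1[simplified])
  then show "emeasure (overshoot g) (space (overshoot g)) = 1" by simp
qed

lemma AE_overshoot_pos: "AE r in overshoot g. 0 < r"
proof (rule AE_I[of _ _ "{..0}"])
  have "emeasure (overshoot g) {..0} = (\<integral>\<^sup>+r. indicator {..0} r \<partial>overshoot g)" by simp
  also have "\<dots> = (\<integral>\<^sup>+u. 0 \<partial>\<Phi>)"
    by (subst nn_integral_overshoot) (auto intro!: nn_integral_cong simp: indicator_def nn_integral_0_iff_AE)
  finally show "emeasure (overshoot g) {..0} = 0" by simp
qed auto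

text \<open>The renewal measure above level \<open>g\<close> is a fresh renewal measure, started at the position of first
  passage.\<close>

lemma renewal_after_passage:
  assumes [measurable]: "\<phi> \<in> borel_measurable borel" and g: "0 \<le> g"
    and zero: "\<And>p. p \<le> g \<Longrightarrow> \<phi> p = 0"
    and bound: "\<And>p. 0 \<le> p \<Longrightarrow> p \<le> g \<Longrightarrow> (\<integral>\<^sup>+v. \<phi> (p + v) \<partial>\<Phi>) \<le> ennreal C"
  shows "(\<integral>\<^sup>+v. \<phi> v \<partial>\<Phi>) = (\<integral>\<^sup>+r. \<integral>\<^sup>+v. \<phi> (g + r + v) \<partial>\<Phi> \<partial>overshoot g)"
proof -
  have "(\<integral>\<^sup>+v. \<phi> (0 + v) \<partial>\<Phi>) = (\<integral>\<^sup>+r. \<integral>\<^sup>+v. \<phi> (g + r + v) \<partial>\<Phi> \<partial>overshoot g)"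
  proof (rule first_passage[OF _ g])
    fix p assume "p \<le> g"
    then show "(\<integral>\<^sup>+v. \<phi> (p + v) \<partial>\<Phi>) = (\<integral>\<^sup>+t. \<integral>\<^sup>+v. \<phi> (p + t + v) \<partial>\<Phi> \<partial>F)"
      by (subst renewal_equation) (auto simp: zero)
  qed (use bound in auto)
  then show ?thesis by simp
qed

text \<open>This constant bounds the renewal measure of every half-open unit interval; see
  \<open>renewal_unit_interval_le\<close>.\<close>

definition unit_bound :: real where "unit_bound = measure \<Phi> {..1}"

lemma emeasure_unit_bound: "emeasure \<Phi> {..1} = ennreal unit_bound"
  unfolding unit_bound_def using emeasure_renewal_atMost[of 1] by (intro emeasure_eq_ennreal_measure) auto

lemma unit_bound_nonneg: "0 \<le> unit_bound"
  by (simp add: unit_bound_def)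

text \<open>After first passage above \<open>x - 1\<close> the walk starts afresh inside or beyond the interval, so only visits within
  distance one of the new starting point still fall into it.\<close>

lemma renewal_unit_interval_le: "emeasure \<Phi> {x - 1<..x} \<le> ennreal unit_bound"
proof (cases "x \<le> 1")
  case True
  then show ?thesis
    unfolding emeasure_unit_bound[symmetric] by (intro emeasure_mono) auto
next
  case False
  interpret O: prob_space "overshoot (x - 1)" using False by (intro prob_space_overshoot) auto
  have ind: "(\<integral>\<^sup>+v. indicator {x - 1<..x} (p + v) \<partial>\<Phi>) = emeasure \<Phi> {x - 1 - p<..x - p}" for p
  proof -
    have "(\<integral>\<^sup>+v. indicator {x - 1<..x} (p + v) \<partial>\<Phi>) = (\<integral>\<^sup>+v. indicator {x - 1 - p<..x - p} v \<partial>\<Phi>)"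
      by (intro nn_integral_cong) (auto simp: indicator_def)
    then show ?thesis by simp
  qed
  have "emeasure \<Phi> {x - 1<..x} = (\<integral>\<^sup>+v. indicator {x - 1<..x} v \<partial>\<Phi>)" by simp
  also have "\<dots> = (\<integral>\<^sup>+r. \<integral>\<^sup>+v. indicator {x - 1<..x} (x - 1 + r + v) \<partial>\<Phi> \<partial>overshoot (x - 1))"
  proof (rule renewal_after_passage[where C = "measure \<Phi> {..x}"])
    fix p :: real assume "0 \<le> p"
    then have "emeasure \<Phi> {x - 1 - p<..x - p} \<le> emeasure \<Phi> {..x}" by (intro emeasure_mono) auto
    also have "\<dots> = ennreal (measure \<Phi> {..x})"
      using emeasure_renewal_atMost[of x] by (intro emeasure_eq_ennreal_measure) auto
    finally show "(\<integral>\<^sup>+v. indicator {x - 1<..x} (p + v) \<partial>\<Phi>) \<le> ennreal (measure \<Phi> {..x})"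
      unfolding ind .
  qed (use False in \<open>auto simp: indicator_def\<close>)
  also have "\<dots> \<le> (\<integral>\<^sup>+r. ennreal unit_bound \<partial>overshoot (x - 1))"
  proof (intro nn_integral_mono_AE, use AE_overshoot_pos in eventually_elim)
    fix r :: real assume "0 < r"
    then show "(\<integral>\<^sup>+v. indicator {x - 1<..x} (x - 1 + r + v) \<partial>\<Phi>) \<le> ennreal unit_bound"
      unfolding emeasure_unit_bound[symmetric] ind by (intro emeasure_mono) auto
  qed
  also have "\<dots> = ennreal unit_bound" by (simp add: O.emeasure_space_1[simplified])
  finally show ?thesis .
qed

lemma renewal_interval_le:
  assumes "0 \<le> l"
  shows "emeasure \<Phi> {x - l<..x} \<le> ennreal (unit_bound * (l + 1))"
proof -
  have *: "emeasure \<Phi> {x - real n<..x} \<le> ennreal (unit_bound * real n)" for n x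
  proof (induction n arbitrary: x)
    case (Suc n)
    have "emeasure \<Phi> {x - real (Suc n)<..x} \<le> emeasure \<Phi> ({x - 1<..x} \<union> {x - 1 - real n<..x - 1})"
      by (intro emeasure_mono) auto
    also have "\<dots> \<le> emeasure \<Phi> {x - 1<..x} + emeasure \<Phi> {x - 1 - real n<..x - 1}"
      by (rule emeasure_subadditive) auto
    also have "\<dots> \<le> ennreal unit_bound + ennreal (unit_bound * real n)"
      by (intro add_mono Suc renewal_unit_interval_le)
    also have "\<dots> = ennreal (unit_bound * real (Suc n))"
      using unit_bound_nonneg by (subst ennreal_plus[symmetric]) (auto simp: algebra_simps)
    finally show ?case .
  qed simp
  obtain n :: nat where n: "l \<le> real n" "real n \<le> l + 1"
    using assms by (intro that[of "nat \<lceil>l\<rceil>"]) linarith+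
  have "emeasure \<Phi> {x - l<..x} \<le> emeasure \<Phi> {x - real n<..x}"
    using n by (intro emeasure_mono) auto
  also have "\<dots> \<le> ennreal (unit_bound * real n)" by (rule *)
  also have "\<dots> \<le> ennreal (unit_bound * (l + 1))"
    using n unit_bound_nonneg by (intro ennreal_leI mult_left_mono) auto
  finally show ?thesis .
qed

text \<open>An overshoot beyond \<open>\<rho>\<close> caused by a step \<open>t\<close> needs a last visit within distance \<open>t - \<rho>\<close> below \<open>g\<close>, and
  the renewal measure of that interval is at most \<open>unit_bound * (t - \<rho> + 1)\<close>. The bound does not depend
  on the level \<open>g\<close>.\<close>

lemma overshoot_tail_le:
  assumes \<rho>: "1 \<le> \<rho>"
  shows "emeasure (overshoot g) {\<rho><..} \<le> ennreal unit_bound * (\<integral>\<^sup>+t. ennreal t * indicator {\<rho><..} t \<partial>F)"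
proof -
  interpret P: pair_sigma_finite \<Phi> F ..
  have "emeasure (overshoot g) {\<rho><..} = (\<integral>\<^sup>+r. indicator {\<rho><..} r \<partial>overshoot g)" by simp
  also have "\<dots> = (\<integral>\<^sup>+u. \<integral>\<^sup>+t. indicator {..g} u * (indicator {g<..} (u + t) * indicator {\<rho><..} (u + t - g)) \<partial>F \<partial>\<Phi>)"
    by (subst nn_integral_overshoot) (auto simp: nn_integral_cmult)
  also have "\<dots> = (\<integral>\<^sup>+t. \<integral>\<^sup>+u. indicator {..g} u * (indicator {g<..} (u + t) * indicator {\<rho><..} (u + t - g)) \<partial>\<Phi> \<partial>F)"
    by (rule P.Fubini'[symmetric]) measurable
  also have "\<dots> \<le> (\<integral>\<^sup>+t. ennreal unit_bound * (ennreal t * indicator {\<rho><..} t) \<partial>F)"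
  proof (rule nn_integral_mono)
    fix t :: real
    show "(\<integral>\<^sup>+u. indicator {..g} u * (indicator {g<..} (u + t) * indicator {\<rho><..} (u + t - g)) \<partial>\<Phi>)
        \<le> ennreal unit_bound * (ennreal t * indicator {\<rho><..} t)"
    proof (cases "\<rho> < t")
      case True
      have "(\<integral>\<^sup>+u. indicator {..g} u * (indicator {g<..} (u + t) * indicator {\<rho><..} (u + t - g)) \<partial>\<Phi>)
         \<le> (\<integral>\<^sup>+u. indicator {g - (t - \<rho>)<..g} u \<partial>\<Phi>)"
        by (intro nn_integral_mono) (auto simp: indicator_def)
      also have "\<dots> = emeasure \<Phi> {g - (t - \<rho>)<..g}" by (rule nn_integral_indicator) auto
      also have "\<dots> \<le> ennreal (unit_bound * (t - \<rho> + 1))"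
        using True by (intro renewal_interval_le) auto
      also have "\<dots> \<le> ennreal (unit_bound * t)"
        using \<rho> unit_bound_nonneg by (intro ennreal_leI mult_left_mono) auto
      also have "\<dots> = ennreal unit_bound * ennreal t" using unit_bound_nonneg True \<rho> by (simp add: ennreal_mult)
      finally show ?thesis using True by simp
    next
      case False
      then have "(\<integral>\<^sup>+u. indicator {..g} u * (indicator {g<..} (u + t) * indicator {\<rho><..} (u + t - g)) \<partial>\<Phi>)
         = (\<integral>\<^sup>+u. 0 \<partial>\<Phi>)"
        by (intro nn_integral_cong) (auto simp: indicator_def)
      then show ?thesis by simp
    qed
  qed
  also have "\<dots> = ennreal unit_bound * (\<integral>\<^sup>+t. ennreal t * indicator {\<rho><..} t \<partial>F)"
    by (rule nn_integral_cmult) measurable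
  finally show ?thesis .
qed

end

section \<open>Spread-out laws and minorization of overshoots\<close>

context renewal_law begin

text \<open>A nonzero density is bounded away from zero on some set of positive and finite measure.\<close>

lemma spread_out_indicator_minorant:
  assumes "spread_out F"
  obtains n A c where "A \<in> sets borel" "0 < emeasure lborel A" "emeasure lborel A < \<infinity>" "(0::real) < c"
    "density_minorant (\<lambda>x. ennreal c * indicator A x) (conv_power F n)"
proof -
  obtain n G where setsG: "sets G = sets borel" and G0: "G \<noteq> null_measure borel"
    and Gle: "\<And>A. A \<in> sets borel \<Longrightarrow> emeasure G A \<le> emeasure (conv_power F n) A"
    and ac: "absolutely_continuous lborel G"
    using assms unfolding spread_out_def by auto
  obtain h where h [measurable]: "h \<in> borel_measurable borel" and hG: "density lborel h = G"
    using sigma_finite_measure.Radon_Nikodym[OF sigma_finite_lborel ac] setsG by auto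
  define A where "A k = {x. \<bar>x\<bar> \<le> real k \<and> ennreal (1 / real (Suc k)) \<le> h x}" for k
  have [measurable]: "A k \<in> sets borel" for k unfolding A_def by measurable
  \<comment> \<open>The sets \<open>A k\<close> exhaust the set where the density is positive.\<close>
  have "\<exists>k. emeasure lborel (A k) \<noteq> 0"
  proof (rule ccontr)
    assume "\<not> ?thesis"
    then have "emeasure lborel (\<Union>k. A k) = 0" by (intro emeasure_UN_eq_0) auto
    then have "AE x in lborel. x \<notin> (\<Union>k. A k)" by (intro AE_not_in) auto
    moreover have "h x = 0" if "x \<notin> (\<Union>k. A k)" for x
    proof (rule ccontr)
      assume "h x \<noteq> 0"
      then obtain e where e: "e > 0" "ennreal e \<le> h x"
        by (metis ennreal_cases ennreal_eq_0_iff linorder_not_le order_refl top_greatest zero_less_one)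
      obtain k where k: "1 / real (Suc k) < e" "\<bar>x\<bar> \<le> real k"
      proof -
        obtain k1 where "1 / real (Suc k1) < e" using e nat_approx_posE by blast
        moreover have "1 / real (Suc (k1 + nat \<lceil>\<bar>x\<bar>\<rceil>)) \<le> 1 / real (Suc k1)" by (simp add: frac_le)
        ultimately show ?thesis by (intro that[of "k1 + nat \<lceil>\<bar>x\<bar>\<rceil>"]) linarith+
      qed
      then have "x \<in> A k" using e by (auto simp: A_def intro!: order_trans[OF ennreal_leI e(2)])
      with that show False by auto
    qed
    ultimately have "AE x in lborel. h x = 0" by (auto elim!: eventually_mono)
    then have "emeasure G B = 0" if "B \<in> sets borel" for B
      using that unfolding hG[symmetric] by (subst emeasure_density) (auto simp: nn_integral_0_iff_AE elim!: eventually_mono)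
    then have "G = null_measure borel" by (intro measure_eqI) (auto simp: setsG)
    with G0 show False by simp
  qed
  then obtain k where k: "emeasure lborel (A k) \<noteq> 0" by auto
  have fin: "emeasure lborel (A k) < \<infinity>"
  proof -
    have "emeasure lborel (A k) \<le> emeasure lborel {- real k..real k}"
      by (intro emeasure_mono) (auto simp: A_def)
    then show ?thesis by (rule order_le_less_trans) simp
  qed
  have "density_minorant (\<lambda>x. ennreal (1 / real (Suc k)) * indicator (A k) x) (conv_power F n)"
    unfolding density_minorant_def
  proof (intro conjI ballI)
    fix \<phi> :: "real \<Rightarrow> ennreal" assume [measurable]: "\<phi> \<in> borel_measurable borel"
    have "(\<integral>\<^sup>+x. ennreal (1 / real (Suc k)) * indicator (A k) x * \<phi> x \<partial>lborel) \<le> (\<integral>\<^sup>+x. h x * \<phi> x \<partial>lborel)"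
      by (intro nn_integral_mono) (auto simp: A_def indicator_def intro!: mult_right_mono)
    also have "\<dots> = (\<integral>\<^sup>+x. \<phi> x \<partial>G)" unfolding hG[symmetric] by (subst nn_integral_density) auto
    also have "\<dots> \<le> (\<integral>\<^sup>+x. \<phi> x \<partial>conv_power F n)"
      by (rule nn_integral_mono_measure) (auto simp: setsG Gle measurable_cong_sets[OF setsG refl])
    finally show "(\<integral>\<^sup>+x. ennreal (1 / real (Suc k)) * indicator (A k) x * \<phi> x \<partial>lborel) \<le> (\<integral>\<^sup>+x. \<phi> x \<partial>conv_power F n)" .
  qed measurable
  then show ?thesis using k fin by (intro that[of "A k" "1 / real (Suc k)" n]) (auto simp: zero_less_iff_neq_zero)
qed

lemma conv_power_minorant_add:
  assumes "density_minorant k (conv_power F i)" "density_minorant l (conv_power F j)"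
  shows "density_minorant (\<lambda>x. \<integral>\<^sup>+u. k u * l (x - u) \<partial>lborel) (conv_power F (i + j))"
  unfolding conv_power_add
  using assms by (intro density_minorant_convolution finite_measure_conv_power) auto

text \<open>Doubling the number of convolution factors replaces the set of positive measure by an interval.\<close>

lemma spread_out_interval_minorant:
  assumes "spread_out F"
  obtains n a w c where "0 < w" "(0::real) < c"
    "density_minorant (\<lambda>x. ennreal c * indicator {a..a + w} x) (conv_power F n)"
proof -
  obtain n A c where A [measurable]: "A \<in> sets borel" and mA: "0 < emeasure lborel A" "emeasure lborel A < \<infinity>"
    and c: "(0::real) < c" and min: "density_minorant (\<lambda>x. ennreal c * indicator A x) (conv_power F n)"
    by (rule spread_out_indicator_minorant[OF assms])
  obtain a b where ab: "a < b" "ennreal (7/8 * (b - a)) < emeasure lborel (A \<inter> {a..b})"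
    using interval_of_high_density[OF A mA, of "7/8"] by auto
  let ?k = "\<lambda>x. \<integral>\<^sup>+u. (ennreal c * indicator A u) * (ennreal c * indicator A (x - u)) \<partial>lborel"
  let ?J = "{2*a + 3/4*(b-a)..2*a + 3/4*(b-a) + (b-a)/2}"
  have "density_minorant (\<lambda>x. ennreal (c * c * ((b - a) / 2)) * indicator ?J x) (conv_power F (n + n))"
  proof (rule density_minorant_mono[OF conv_power_minorant_add[OF min min]])
    fix x
    have "ennreal (c * c * ((b - a) / 2)) \<le> ?k x" if "x \<in> ?J"
    proof -
      have "ennreal (c * c * ((b - a) / 2)) = ennreal (c * c) * ennreal ((b - a) / 2)"
        using c ab by (intro ennreal_mult) auto
      also have "\<dots> \<le> ennreal (c * c) * (\<integral>\<^sup>+u. indicator A u * indicator A (x - u) \<partial>lborel)"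
        using that ab by (intro mult_left_mono indicator_convolution_ge) (auto simp: field_simps)
      also have "\<dots> = ?k x"
        using c by (subst nn_integral_cmult[symmetric]) (auto simp: ennreal_mult ac_simps)
      finally show ?thesis .
    qed
    then show "ennreal (c * c * ((b - a) / 2)) * indicator ?J x \<le> ?k x"
      by (cases "x \<in> ?J") auto
  qed auto
  then show ?thesis using c ab by (intro that[of "(b-a)/2" "c * c * ((b - a) / 2)"]) auto
qed

text \<open>Convolving once more with the indicator of an interval of length \<open>w\<close> lengthens the interval by
  \<open>w / 2\<close>, at the price of a smaller constant: near the two ends a quarter of \<open>w\<close> is given up so that
  the overlap stays at least \<open>w / 4\<close>.\<close>

lemma spread_out_long_interval_minorant:
  assumes "spread_out F"
  shows "\<exists>n a c. 0 < c \<and> density_minorant (\<lambda>x. ennreal c * indicator {a..a + l} x) (conv_power F n)"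
proof -
  obtain n a w c where w: "0 < w" and c: "(0::real) < c"
    and min: "density_minorant (\<lambda>x. ennreal c * indicator {a..a + w} x) (conv_power F n)"
    by (rule spread_out_interval_minorant[OF assms])
  have "\<exists>n a c. 0 < c \<and> density_minorant (\<lambda>x. ennreal c * indicator {a..a + (w + real j * (w / 2))} x) (conv_power F n)" for j
  proof (induction j)
    case 0
    then show ?case using c min by auto
  next
    case (Suc j)
    define v where "v = w + real j * (w / 2)"
    have wv: "w \<le> v" using w by (simp add: v_def)
    obtain n' a' c' where c': "(0::real) < c'"
      and min': "density_minorant (\<lambda>x. ennreal c' * indicator {a'..a' + v} x) (conv_power F n')"
      using Suc unfolding v_def by blast
    let ?k = "\<lambda>x. \<integral>\<^sup>+u. (ennreal c * indicator {a..a + w} u) * (ennreal c' * indicator {a'..a' + v} (x - u)) \<partial>lborel"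
    let ?J = "{a + a' + w/4..a + a' + w/4 + (w + real (Suc j) * (w / 2))}"
    have "density_minorant (\<lambda>x. ennreal (c * c' * (w / 4)) * indicator ?J x) (conv_power F (n + n'))"
    proof (rule density_minorant_mono[OF conv_power_minorant_add[OF min min']])
      fix x
      have "ennreal (c * c' * (w / 4)) \<le> ?k x" if "x \<in> ?J"
      proof -
        \<comment> \<open>An interval of length \<open>w / 4\<close> on which both indicators in the convolution are \<open>1\<close>.\<close>
        define p where "p = max a (x - a' - v)"
        have x: "a + a' + w/4 \<le> x" "x \<le> a + a' + 3/4 * w + v"
          using that by (auto simp: v_def field_simps)
        have p: "a \<le> p" "p + w/4 \<le> a + w" "a' \<le> x - (p + w/4)" "x - p \<le> a' + v"
          using x w wv by (auto simp: p_def max_def)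
        have "ennreal (c * c' * (w / 4)) = ennreal (c * c') * emeasure lborel {p..p + w/4}"
          using c c' w ennreal_mult[of "c * c'" "w / 4"] by simp
        also have "\<dots> = (\<integral>\<^sup>+u. ennreal (c * c') * indicator {p..p + w/4} u \<partial>lborel)"
          by (simp add: nn_integral_cmult)
        also have "\<dots> \<le> ?k x"
          using p c c' by (intro nn_integral_mono) (auto simp: indicator_def ennreal_mult)
        finally show ?thesis .
      qed
      then show "ennreal (c * c' * (w / 4)) * indicator ?J x \<le> ?k x"
        by (cases "x \<in> ?J") auto
    qed auto
    then show ?case using c c' w by (intro exI[of _ "n + n'"] exI[of _ "a + a' + w/4"] exI[of _ "c * c' * (w/4)"]) auto
  qed note grow = this
  obtain j :: nat where j: "l \<le> w + real j * (w / 2)"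
  proof -
    obtain j :: nat where "l / (w / 2) < real j" using reals_Archimedean2 by blast
    then show ?thesis using w by (intro that[of j]) (auto simp: field_simps)
  qed
  obtain n a c where c: "0 < c"
    and min: "density_minorant (\<lambda>x. ennreal c * indicator {a..a + (w + real j * (w / 2))} x) (conv_power F n)"
    using grow[of j] by blast
  have "density_minorant (\<lambda>x. ennreal c * indicator {a..a + l} x) (conv_power F n)"
    by (rule density_minorant_mono[OF min]) (use j in \<open>auto simp: indicator_def\<close>)
  with c show ?thesis by blast
qed

text \<open>The interval lies in the positive half-line because \<open>\<Phi>\<close> does not charge the negative one.\<close>

lemma spread_out_renewal_minorant:
  assumes "spread_out F" and l: "0 < l"
  obtains a c where "0 \<le> a" "(0::real) < c" "density_minorant (\<lambda>x. ennreal c * indicator {a..a + l} x) \<Phi>"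
proof -
  obtain n a c where c: "(0::real) < c"
    and min: "density_minorant (\<lambda>x. ennreal c * indicator {a..a + l} x) (conv_power F n)"
    using spread_out_long_interval_minorant[OF assms(1)] by blast
  have min: "density_minorant (\<lambda>x. ennreal c * indicator {a..a + l} x) \<Phi>"
    using min by (rule density_minorant_renewal)
  have "0 \<le> a"
  proof (rule ccontr)
    assume a: "\<not> 0 \<le> a"
    define d where "d = min l (- a / 2)"
    have d: "0 < d" "d \<le> l" "a + d < 0" using a l by (auto simp: d_def min_def)
    have "ennreal (c * d) = ennreal c * emeasure lborel {a..a + d}" using c d by (simp add: ennreal_mult)
    also have "\<dots> = (\<integral>\<^sup>+x. ennreal c * indicator {a..a + d} x \<partial>lborel)" by (simp add: nn_integral_cmult)
    also have "\<dots> \<le> (\<integral>\<^sup>+x. ennreal c * indicator {a..a + l} x * indicator {..<0} x \<partial>lborel)"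
      using d by (intro nn_integral_mono) (auto simp: indicator_def)
    also have "\<dots> \<le> (\<integral>\<^sup>+x. indicator {..<0} x \<partial>\<Phi>)" by (rule density_minorantD[OF min]) auto
    also have "\<dots> = (\<integral>\<^sup>+x. 0 \<partial>\<Phi>)"
      by (intro nn_integral_cong_AE, use AE_renewal_nonneg in eventually_elim) auto
    finally have "c * d \<le> 0" by (simp add: ennreal_eq_0_iff)
    then show False using mult_pos_pos[OF c d(1)] by linarith
  qed
  with that c min show ?thesis by blast
qed

end

locale spread_out_renewal = renewal_law +
  assumes finite_mean: "integrable F (\<lambda>t. t)"
    and spread: "spread_out F"
begin

text \<open>The uniform tail bound for overshoots. It is \<open>o(\<rho> powr (1 - s))\<close> when the \<open>s\<close>-th moment is finite,
  and this is the exact place where one power of the moment is lost.\<close>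

definition overshoot_bound :: "real \<Rightarrow> real" where
  "overshoot_bound \<rho> = unit_bound * (\<integral>t. t * indicator {\<rho><..} t \<partial>F)"

lemma integrable_tail: "integrable F (\<lambda>t. t * indicator {\<rho><..} t)"
  using integrable_mult_indicator[OF _ finite_mean, of "{\<rho><..}"] by (simp add: mult.commute)

lemma overshoot_bound_nonneg: "0 \<le> \<rho> \<Longrightarrow> 0 \<le> overshoot_bound \<rho>"
  unfolding overshoot_bound_def using unit_bound_nonneg
  by (intro mult_nonneg_nonneg integral_nonneg_AE) (auto simp: indicator_def)

lemma measure_overshoot_tail:
  assumes "1 \<le> \<rho>"
  shows "measure (overshoot g) {\<rho><..} \<le> overshoot_bound \<rho>"
proof -
  have "(\<integral>\<^sup>+t. ennreal t * indicator {\<rho><..} t \<partial>F) = (\<integral>\<^sup>+t. ennreal (t * indicator {\<rho><..} t) \<partial>F)"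
    by (intro nn_integral_cong) (auto simp: indicator_def)
  also have "\<dots> = ennreal (\<integral>t. t * indicator {\<rho><..} t \<partial>F)"
    using assms by (intro nn_integral_eq_integral integrable_tail) (auto simp: indicator_def)
  finally have "emeasure (overshoot g) {\<rho><..} \<le> ennreal (overshoot_bound \<rho>)"
    using overshoot_tail_le[OF assms, of g] unit_bound_nonneg by (simp add: overshoot_bound_def ennreal_mult')
  then show ?thesis
    using overshoot_bound_nonneg[of \<rho>] assms unfolding measure_def by (intro enn2real_leI) auto
qed

lemma overshoot_bound_tendsto: "(overshoot_bound \<longlongrightarrow> 0) at_top"
proof -
  have "((\<lambda>\<rho>. \<integral>t. t * indicator {\<rho><..} t \<partial>F) \<longlongrightarrow> (\<integral>t. 0 \<partial>F)) at_top"
  proof (rule integral_dominated_convergence_at_top[where w = "\<lambda>t. \<bar>t\<bar>"])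
    show "AE t in F. ((\<lambda>\<rho>. t * indicator {\<rho><..} t) \<longlongrightarrow> 0) at_top"
    proof (rule AE_I2)
      fix t :: real
      have "\<forall>\<^sub>F \<rho> in at_top. t * indicator {\<rho><..} t = 0"
        using eventually_ge_at_top[of t] by eventually_elim auto
      then show "((\<lambda>\<rho>. t * indicator {\<rho><..} t) \<longlongrightarrow> 0) at_top" by (rule tendsto_eventually)
    qed
    show "\<forall>\<^sub>F \<rho> in at_top. AE t in F. norm (t * indicator {\<rho><..} t) \<le> \<bar>t\<bar>"
      by (intro always_eventually allI AE_I2) (simp add: indicator_def)
    show "integrable F (\<lambda>t. \<bar>t\<bar>)" using finite_mean by (rule integrable_abs)
  qed measurable
  then have "((\<lambda>\<rho>. unit_bound * (\<integral>t. t * indicator {\<rho><..} t \<partial>F)) \<longlongrightarrow> unit_bound * 0) at_top"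
    by (intro tendsto_mult_left) simp
  then show ?thesis by (simp add: overshoot_bound_def[abs_def])
qed

text \<open>The minorant lives on one bounded interval only, with a constant that degrades as the interval grows.
  A lower bound that is uniform over all late unit intervals comes from stopping: below the unit
  interval there is a level such that, with probability at least one half, the overshoot over that
  level is at most \<open>R\<close>, and from there the unit interval falls into the range of the minorant.\<close>

lemma renewal_lower_bound:
  obtains \<delta> L where "(0::real) < \<delta>" "1 \<le> L"
    "\<forall>x \<phi> C. L \<le> x \<longrightarrow> \<phi> \<in> borel_measurable borel \<longrightarrow> (\<forall>y. \<phi> y \<le> ennreal C) \<longrightarrow>
       (\<forall>y. y \<notin> {x - 1<..x} \<longrightarrow> \<phi> y = 0) \<longrightarrow>
       ennreal \<delta> * (\<integral>\<^sup>+y. \<phi> y \<partial>lborel) \<le> (\<integral>\<^sup>+y. \<phi> y \<partial>\<Phi>)"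
proof -
  have "\<forall>\<^sub>F \<rho> in at_top. overshoot_bound \<rho> < 1/2"
    using order_tendstoD(2)[OF overshoot_bound_tendsto, of "1/2"] by simp
  then have "\<forall>\<^sub>F \<rho> in at_top. overshoot_bound \<rho> < 1/2 \<and> 1 \<le> \<rho>"
    using eventually_ge_at_top by (rule eventually_conj)
  then obtain R where R: "overshoot_bound R < 1/2" "1 \<le> R" by (rule eventually_happens'[rotated, THEN exE]) auto
  obtain a c where a: "0 \<le> a" and c: "(0::real) < c"
    and min: "density_minorant (\<lambda>x. ennreal c * indicator {a..a + (R + 1)} x) \<Phi>"
    by (rule spread_out_renewal_minorant[OF spread, of "R + 1"]) (use R in auto)
  show ?thesis
  proof (rule that[of "c / 2" "a + R + 1"], goal_cases)
    case 3
    show ?case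
    proof (intro allI impI)
      fix x C and \<phi> :: "real \<Rightarrow> ennreal"
      assume x: "a + R + 1 \<le> x" and [measurable]: "\<phi> \<in> borel_measurable borel"
        and "\<forall>y. \<phi> y \<le> ennreal C" "\<forall>y. y \<notin> {x - 1<..x} \<longrightarrow> \<phi> y = 0"
      then have C: "\<And>y. \<phi> y \<le> ennreal C" and supp: "\<And>y. y \<notin> {x - 1<..x} \<Longrightarrow> \<phi> y = 0"
        by auto
      \<comment> \<open>With an overshoot \<open>r \<in> (0, R]\<close> over this level, the remaining distance to any point of \<open>(x - 1, x]\<close> lies in \<open>[a, a + R + 1]\<close>.\<close>
      define g where "g = x - a - R - 1"
      have g: "0 \<le> g" using x by (simp add: g_def)
      interpret O: prob_space "overshoot g" using g by (rule prob_space_overshoot)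
      define J where "J = (\<integral>\<^sup>+y. \<phi> y \<partial>lborel)"
      have half: "ennreal (1/2) \<le> emeasure (overshoot g) {..R}"
      proof -
        have "measure (overshoot g) {..R} = 1 - measure (overshoot g) {R<..}"
          using O.prob_compl[of "{R<..}"] by (simp add: Compl_eq_Diff_UNIV[symmetric] not_less[symmetric] Compl_greaterThan)
        then have "1/2 \<le> measure (overshoot g) {..R}"
          using measure_overshoot_tail[OF R(2), of g] R(1) by simp
        then show ?thesis unfolding O.emeasure_eq_measure by (rule ennreal_leI)
      qed
      have "ennreal (c / 2) * J = ennreal c * J * ennreal (1/2)"
        using c ennreal_mult[of c "1/2"] by (simp add: ac_simps)
      also have "\<dots> \<le> ennreal c * J * emeasure (overshoot g) {..R}"
        using half by (rule mult_left_mono) simp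
      also have "\<dots> = (\<integral>\<^sup>+r. ennreal c * J * indicator {..R} r \<partial>overshoot g)"
        by (simp add: nn_integral_cmult)
      also have "\<dots> \<le> (\<integral>\<^sup>+r. \<integral>\<^sup>+v. \<phi> (g + r + v) \<partial>\<Phi> \<partial>overshoot g)"
      proof (intro nn_integral_mono_AE, use AE_overshoot_pos in eventually_elim)
        fix r :: real assume r: "0 < r"
        have "ennreal c * J \<le> (\<integral>\<^sup>+v. \<phi> (g + r + v) \<partial>\<Phi>)" if "r \<le> R"
        proof -
          have "J = (\<integral>\<^sup>+v. \<phi> (g + r + v) \<partial>lborel)"
            unfolding J_def by (subst nn_integral_real_affine[where c = 1 and t = "g + r"]) auto
          then have "ennreal c * J = (\<integral>\<^sup>+v. ennreal c * \<phi> (g + r + v) \<partial>lborel)"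
            by (simp add: nn_integral_cmult)
          also have "\<dots> = (\<integral>\<^sup>+v. ennreal c * indicator {a..a + (R + 1)} v * \<phi> (g + r + v) \<partial>lborel)"
            using r that by (intro nn_integral_cong) (auto simp: indicator_def g_def intro!: supp)
          also have "\<dots> \<le> (\<integral>\<^sup>+v. \<phi> (g + r + v) \<partial>\<Phi>)" by (rule density_minorantD[OF min]) measurable
          finally show ?thesis .
        qed
        then show "ennreal c * J * indicator {..R} r \<le> (\<integral>\<^sup>+v. \<phi> (g + r + v) \<partial>\<Phi>)"
          by (cases "r \<le> R") auto
      qed
      also have "\<dots> = (\<integral>\<^sup>+y. \<phi> y \<partial>\<Phi>)"
      proof (rule renewal_after_passage[symmetric, where C = "\<bar>C\<bar> * unit_bound"])
        show "\<phi> p = 0" if "p \<le> g" for p using that a R by (intro supp) (auto simp: g_def)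
        fix p
        have "(\<integral>\<^sup>+v. \<phi> (p + v) \<partial>\<Phi>) \<le> (\<integral>\<^sup>+v. ennreal \<bar>C\<bar> * indicator {x - p - 1<..x - p} v \<partial>\<Phi>)"
        proof (rule nn_integral_mono)
          fix v show "\<phi> (p + v) \<le> ennreal \<bar>C\<bar> * indicator {x - p - 1<..x - p} v"
            using C[of "p + v"] supp[of "p + v"]
            by (cases "v \<in> {x - p - 1<..x - p}") (auto intro: order_trans ennreal_leI)
        qed
        also have "\<dots> \<le> ennreal \<bar>C\<bar> * ennreal unit_bound"
          by (simp add: nn_integral_cmult mult_left_mono renewal_unit_interval_le)
        finally show "(\<integral>\<^sup>+v. \<phi> (p + v) \<partial>\<Phi>) \<le> ennreal (\<bar>C\<bar> * unit_bound)"
          by (simp add: ennreal_mult unit_bound_nonneg)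
      qed (use g in auto)
      finally show "ennreal (c / 2) * (\<integral>\<^sup>+y. \<phi> y \<partial>lborel) \<le> (\<integral>\<^sup>+y. \<phi> y \<partial>\<Phi>)" by (simp add: J_def)
    qed
  qed (use a c R in auto)
qed

lemma positive_tail_point: obtains v0 where "0 < v0" "v0 \<le> 1" "0 < measure F {v0<..}"
proof (rule ccontr)
  assume "\<not> thesis"
  then have "measure F {1 / real (Suc n)<..} = 0" for n
    using that[of "1 / real (Suc n)"] by (auto simp: zero_less_measure_iff)
  then have "emeasure F {1 / real (Suc n)<..} = 0" for n by (simp add: F.emeasure_eq_measure)
  then have "emeasure F (\<Union>n. {1 / real (Suc n)<..}) = 0"
    by (intro emeasure_UN_eq_0) auto
  then have "AE t in F. t \<notin> (\<Union>n. {1 / real (Suc n)<..})" by (intro AE_not_in) auto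
  with pos_F have "AE t in F. False"
  proof eventually_elim
    fix t :: real assume "0 < t" "t \<notin> (\<Union>n. {1 / real (Suc n)<..})"
    then show False using nat_approx_posE[of t] by auto
  qed
  then show False by simp
qed

text \<open>All overshoot laws over high levels dominate one common nonzero measure \<open>\<beta>\<close>: restricting the last
  visit to the unit interval below \<open>g\<close> and replacing \<open>\<Phi>\<close> there by a multiple of Lebesgue measure removes
  the dependence on \<open>g\<close>. The conclusion is stated in the only form that the contraction uses, so that
  \<open>\<beta>\<close> itself need not be exported: it lets two different laws be compared with functions whose sum is
  bounded below.\<close>

lemma overshoot_minorization:
  obtains \<epsilon> L where "0 < \<epsilon>" "\<epsilon> < 1" "1 \<le> L"
    "\<forall>g1 g2 \<phi>1 \<phi>2 C d. L \<le> g1 \<longrightarrow> L \<le> g2 \<longrightarrow> \<phi>1 \<in> borel_measurable borel \<longrightarrow> \<phi>2 \<in> borel_measurable borel \<longrightarrow>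
      (\<forall>r. \<phi>1 r \<le> ennreal C) \<longrightarrow> (\<forall>r. \<phi>2 r \<le> ennreal C) \<longrightarrow> (\<forall>r. ennreal d \<le> \<phi>1 r + \<phi>2 r) \<longrightarrow> 0 \<le> d \<longrightarrow>
      ennreal (\<epsilon> * d) \<le> (\<integral>\<^sup>+r. \<phi>1 r \<partial>overshoot g1) + (\<integral>\<^sup>+r. \<phi>2 r \<partial>overshoot g2)"
proof -
  obtain \<delta> L where \<delta>: "(0::real) < \<delta>" and L: "1 \<le> L" and lower:
    "\<forall>x \<phi> C. L \<le> x \<longrightarrow> \<phi> \<in> borel_measurable borel \<longrightarrow> (\<forall>y. \<phi> y \<le> ennreal C) \<longrightarrow>
       (\<forall>y. y \<notin> {x - 1<..x} \<longrightarrow> \<phi> y = 0) \<longrightarrow>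
       ennreal \<delta> * (\<integral>\<^sup>+y. \<phi> y \<partial>lborel) \<le> (\<integral>\<^sup>+y. \<phi> y \<partial>\<Phi>)"
    by (rule renewal_lower_bound)
  obtain v0 where v0: "0 < v0" "v0 \<le> 1" "0 < measure F {v0<..}" by (rule positive_tail_point)
  define \<beta> where "\<beta> \<phi> = (\<integral>\<^sup>+v. indicator {0..<1} v * (\<integral>\<^sup>+t. indicator {0<..} (t - v) * \<phi> (t - v) \<partial>F) \<partial>lborel)"
    for \<phi> :: "real \<Rightarrow> ennreal"
  have dom: "ennreal \<delta> * \<beta> \<phi> \<le> (\<integral>\<^sup>+r. \<phi> r \<partial>overshoot g)"
    if [measurable]: "\<phi> \<in> borel_measurable borel" and C: "\<And>r. \<phi> r \<le> ennreal C" and g: "L \<le> g" for \<phi> C g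
  proof -
    define \<psi> where "\<psi> u = indicator {g - 1<..g} u * (\<integral>\<^sup>+t. indicator {g<..} (u + t) * \<phi> (u + t - g) \<partial>F)" for u
    have [measurable]: "\<psi> \<in> borel_measurable borel" unfolding \<psi>_def by measurable
    have "\<beta> \<phi> = (\<integral>\<^sup>+v. \<psi> (g - v) \<partial>lborel)"
      unfolding \<beta>_def
    proof (rule nn_integral_cong)
      fix v
      have "(\<integral>\<^sup>+t. indicator {0<..} (t - v) * \<phi> (t - v) \<partial>F) = (\<integral>\<^sup>+t. indicator {g<..} (g - v + t) * \<phi> (g - v + t - g) \<partial>F)"
        by (intro nn_integral_cong) (auto simp: indicator_def)
      then show "indicator {0..<1} v * (\<integral>\<^sup>+t. indicator {0<..} (t - v) * \<phi> (t - v) \<partial>F) = \<psi> (g - v)"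
        by (auto simp: \<psi>_def indicator_def)
    qed
    also have "\<dots> = (\<integral>\<^sup>+u. \<psi> u \<partial>lborel)"
      by (subst nn_integral_real_affine[where c = "-1" and t = g and f = \<psi>]) auto
    finally have "ennreal \<delta> * \<beta> \<phi> = ennreal \<delta> * (\<integral>\<^sup>+u. \<psi> u \<partial>lborel)" by simp
    also have "\<dots> \<le> (\<integral>\<^sup>+u. \<psi> u \<partial>\<Phi>)"
    proof (rule lower[rule_format, OF g, where C = C])
      fix u
      have "(\<integral>\<^sup>+t. indicator {g<..} (u + t) * \<phi> (u + t - g) \<partial>F) \<le> (\<integral>\<^sup>+t. ennreal C \<partial>F)"
        using C by (intro nn_integral_mono) (auto simp: indicator_def)
      then show "\<psi> u \<le> ennreal C" by (auto simp: \<psi>_def indicator_def F.emeasure_space_1[simplified])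
    qed (auto simp: \<psi>_def)
    also have "\<dots> \<le> (\<integral>\<^sup>+r. \<phi> r \<partial>overshoot g)"
      by (subst nn_integral_overshoot, measurable) (auto simp: \<psi>_def indicator_def intro!: nn_integral_mono)
    finally show ?thesis .
  qed
  define b where "b = v0 * measure F {v0<..}"
  have b: "0 < b" using v0 by (simp add: b_def)
  \<comment> \<open>The factor \<open>b\<close> is a positive lower bound for the total mass of \<open>\<beta>\<close>: only \<open>v < v0\<close> and steps beyond \<open>v0\<close> are kept.\<close>
  have mass: "ennreal (d * b) \<le> \<beta> \<phi>" if d: "\<And>r. ennreal d \<le> \<phi> r" "0 \<le> d" for \<phi> d
  proof -
    have "ennreal (d * b) = (\<integral>\<^sup>+v. ennreal (d * measure F {v0<..}) * indicator {0..<v0} v \<partial>lborel)"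
      using v0 d ennreal_mult[of "d * measure F {v0<..}" v0] by (subst nn_integral_cmult_indicator) (auto simp: b_def ac_simps)
    also have "\<dots> \<le> \<beta> \<phi>"
      unfolding \<beta>_def
    proof (rule nn_integral_mono)
      fix v
      have "ennreal (d * measure F {v0<..}) \<le> (\<integral>\<^sup>+t. indicator {0<..} (t - v) * \<phi> (t - v) \<partial>F)" if "v < v0"
      proof -
        have "ennreal (d * measure F {v0<..}) = (\<integral>\<^sup>+t. ennreal d * indicator {v0<..} t \<partial>F)"
          using d by (simp add: nn_integral_cmult ennreal_mult F.emeasure_eq_measure)
        also have "\<dots> \<le> (\<integral>\<^sup>+t. indicator {0<..} (t - v) * \<phi> (t - v) \<partial>F)"
          using d that by (intro nn_integral_mono) (auto simp: indicator_def)
        finally show ?thesis .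
      qed
      then show "ennreal (d * measure F {v0<..}) * indicator {0..<v0} v
          \<le> indicator {0..<1} v * (\<integral>\<^sup>+t. indicator {0<..} (t - v) * \<phi> (t - v) \<partial>F)"
        using v0 by (auto simp: indicator_def)
    qed
    finally show ?thesis .
  qed
  have add: "\<beta> (\<lambda>r. \<phi>1 r + \<phi>2 r) = \<beta> \<phi>1 + \<beta> \<phi>2"
    if "\<phi>1 \<in> borel_measurable borel" "\<phi>2 \<in> borel_measurable borel"
    for \<phi>1 \<phi>2 :: "real \<Rightarrow> ennreal"
  proof -
    note [measurable] = that
    have "\<beta> (\<lambda>r. \<phi>1 r + \<phi>2 r) = (\<integral>\<^sup>+v. indicator {0..<1} v * (\<integral>\<^sup>+t. indicator {0<..} (t - v) * \<phi>1 (t - v) \<partial>F)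
        + indicator {0..<1} v * (\<integral>\<^sup>+t. indicator {0<..} (t - v) * \<phi>2 (t - v) \<partial>F) \<partial>lborel)"
      unfolding \<beta>_def by (simp add: distrib_left nn_integral_add)
    also have "\<dots> = \<beta> \<phi>1 + \<beta> \<phi>2" unfolding \<beta>_def by (rule nn_integral_add) measurable
    finally show ?thesis .
  qed
  show ?thesis
  proof (rule that[of "min (\<delta> * b) (1/2)" L], goal_cases)
    case 4
    show ?case
    proof (intro allI impI)
      fix g1 g2 C d :: real and \<phi>1 \<phi>2 :: "real \<Rightarrow> ennreal"
      assume *: "L \<le> g1" "L \<le> g2" "\<phi>1 \<in> borel_measurable borel" "\<phi>2 \<in> borel_measurable borel"
        "\<forall>r. \<phi>1 r \<le> ennreal C" "\<forall>r. \<phi>2 r \<le> ennreal C" "\<forall>r. ennreal d \<le> \<phi>1 r + \<phi>2 r" "0 \<le> d"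
      have "ennreal (min (\<delta> * b) (1/2) * d) \<le> ennreal (\<delta> * (d * b))"
        using mult_right_mono[OF min.cobounded1 \<open>0 \<le> d\<close>, of "\<delta> * b" "1/2"] by (intro ennreal_leI) (simp add: ac_simps)
      also have "\<dots> = ennreal \<delta> * ennreal (d * b)" using \<delta> b * by (intro ennreal_mult) auto
      also have "\<dots> \<le> ennreal \<delta> * \<beta> (\<lambda>r. \<phi>1 r + \<phi>2 r)" using * by (intro mult_left_mono mass; simp)
      also have "\<dots> = ennreal \<delta> * \<beta> \<phi>1 + ennreal \<delta> * \<beta> \<phi>2" using * by (simp add: add distrib_left)
      also have "\<dots> \<le> (\<integral>\<^sup>+r. \<phi>1 r \<partial>overshoot g1) + (\<integral>\<^sup>+r. \<phi>2 r \<partial>overshoot g2)"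
        by (intro add_mono dom[OF *(3) *(5)[rule_format] *(1)] dom[OF *(4) *(6)[rule_format] *(2)])
      finally show "ennreal (min (\<delta> * b) (1/2) * d) \<le> (\<integral>\<^sup>+r. \<phi>1 r \<partial>overshoot g1) + (\<integral>\<^sup>+r. \<phi>2 r \<partial>overshoot g2)" .
    qed
  qed (use \<delta> b L in auto)
qed

end

section \<open>Oscillation of potentials\<close>

context renewal_law begin

text \<open>The test functions against which the renewal measure is compared with Lebesgue measure. Working with
  all of them at once amounts to total variation on unit intervals.\<close>

definition unit_profile :: "(real \<Rightarrow> real) \<Rightarrow> bool" where
  "unit_profile f \<longleftrightarrow> f \<in> borel_measurable borel \<and> (\<forall>x. 0 \<le> f x \<and> f x \<le> 1) \<and> (\<forall>x. x \<notin> {0..<1} \<longrightarrow> f x = 0)"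

text \<open>The convolution of \<open>f\<close> with the renewal measure. It is also the expected value of the sum of \<open>f\<close> along
  a walk that starts at \<open>x\<close> and moves downwards.\<close>

definition potential :: "(real \<Rightarrow> real) \<Rightarrow> real \<Rightarrow> real" where
  "potential f x = enn2real (\<integral>\<^sup>+v. ennreal (f (x - v)) \<partial>\<Phi>)"

lemma unit_profileD:
  assumes "unit_profile f"
  shows "f \<in> borel_measurable borel" "0 \<le> f x" "f x \<le> 1" "x \<notin> {0..<1} \<Longrightarrow> f x = 0"
  using assms by (auto simp: unit_profile_def)

lemma unit_profile_indicator: "unit_profile (indicator {0..<1})"
  by (auto simp: unit_profile_def indicator_def)

lemma nn_integral_profile_le:
  assumes "unit_profile f"
  shows "(\<integral>\<^sup>+v. ennreal (f (x - v)) \<partial>\<Phi>) \<le> ennreal unit_bound"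
proof -
  have "(\<integral>\<^sup>+v. ennreal (f (x - v)) \<partial>\<Phi>) \<le> (\<integral>\<^sup>+v. indicator {x - 1<..x} v \<partial>\<Phi>)"
    using unit_profileD[OF assms] by (intro nn_integral_mono) (auto simp: indicator_def)
  also have "\<dots> \<le> ennreal unit_bound" using renewal_unit_interval_le[of x] by simp
  finally show ?thesis .
qed

lemma ennreal_potential:
  assumes "unit_profile f"
  shows "ennreal (potential f x) = (\<integral>\<^sup>+v. ennreal (f (x - v)) \<partial>\<Phi>)"
  unfolding potential_def
  by (intro ennreal_enn2real order_le_less_trans[OF nn_integral_profile_le[OF assms]]) simp

lemma potential_nonneg: "0 \<le> potential f x"
  by (simp add: potential_def)

lemma potential_le: "unit_profile f \<Longrightarrow> potential f x \<le> unit_bound"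
  using nn_integral_profile_le[of f x] ennreal_potential[of f x] unit_bound_nonneg by (metis ennreal_le_iff)

lemma potential_measurable [measurable]:
  assumes "unit_profile f"
  shows "potential f \<in> borel_measurable borel"
proof -
  have [measurable]: "f \<in> borel_measurable borel" using assms by (rule unit_profileD)
  show ?thesis unfolding potential_def[abs_def] by measurable
qed

lemma integrable_overshoot_bounded:
  fixes \<phi> :: "real \<Rightarrow> real"
  assumes "0 \<le> g" "\<phi> \<in> borel_measurable borel" "\<And>r. \<bar>\<phi> r\<bar> \<le> C"
  shows "integrable (overshoot g) \<phi>"
proof -
  interpret O: prob_space "overshoot g" using assms(1) by (rule prob_space_overshoot)
  show ?thesis using assms by (intro O.integrable_const_bound[where B = C]) auto
qed

text \<open>For the walk moving downwards from \<open>l + g\<close>, nothing is collected above level \<open>l \<ge> 1\<close>, so the potential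
  is the average of the potential at the first position below \<open>l\<close>.\<close>

lemma potential_after_passage:
  assumes f: "unit_profile f" and l: "1 \<le> l" and g: "0 \<le> g"
  shows "potential f (l + g) = (\<integral>r. potential f (l - r) \<partial>overshoot g)"
proof -
  have [measurable]: "f \<in> borel_measurable borel" using f by (rule unit_profileD)
  have [measurable]: "potential f \<in> borel_measurable borel" using f by (rule potential_measurable)
  have "ennreal (potential f (l + g)) = (\<integral>\<^sup>+v. ennreal (f (l + g - v)) \<partial>\<Phi>)"
    using f by (rule ennreal_potential)
  also have "\<dots> = (\<integral>\<^sup>+r. \<integral>\<^sup>+v. ennreal (f (l + g - (g + r + v))) \<partial>\<Phi> \<partial>overshoot g)"
  proof (rule renewal_after_passage[where C = unit_bound])
    show "ennreal (f (l + g - p)) = 0" if "p \<le> g" for p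
      using that l unit_profileD(4)[OF f, of "l + g - p"] by auto
    show "(\<integral>\<^sup>+v. ennreal (f (l + g - (p + v))) \<partial>\<Phi>) \<le> ennreal unit_bound" for p
      using nn_integral_profile_le[OF f, of "l + g - p"] by (simp add: algebra_simps)
  qed (use g in auto)
  also have "\<dots> = (\<integral>\<^sup>+r. ennreal (potential f (l - r)) \<partial>overshoot g)"
    by (intro nn_integral_cong) (simp add: ennreal_potential[OF f] algebra_simps)
  also have "\<dots> = ennreal (\<integral>r. potential f (l - r) \<partial>overshoot g)"
    using potential_nonneg potential_le[OF f]
    by (intro nn_integral_eq_integral integrable_overshoot_bounded[OF g, where C = unit_bound]) auto
  finally show ?thesis
    by (subst (asm) ennreal_inj) (auto intro: potential_nonneg Bochner_Integration.integral_nonneg)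
qed

text \<open>The supremum is taken over all profiles as well, so estimates of the oscillation are automatically
  uniform in the profile.\<close>

definition oscillation :: "real \<Rightarrow> real" where
  "oscillation t = (SUP (f, x, y) \<in> {(f, x, y). unit_profile f \<and> t \<le> x \<and> t \<le> y}. \<bar>potential f x - potential f y\<bar>)"

lemma potential_diff_le: "unit_profile f \<Longrightarrow> \<bar>potential f x - potential f y\<bar> \<le> unit_bound"
  using potential_le[of f x] potential_le[of f y] potential_nonneg[of f x] potential_nonneg[of f y] by linarith

lemma oscillation_upper:
  assumes "unit_profile f" "t \<le> x" "t \<le> y"
  shows "\<bar>potential f x - potential f y\<bar> \<le> oscillation t"
  unfolding oscillation_def
  using assms by (intro cSUP_upper2[where x = "(f, x, y)"]) (auto intro!: bdd_aboveI[where M = unit_bound] potential_diff_le)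

lemma oscillation_least:
  assumes "\<And>f x y. unit_profile f \<Longrightarrow> t \<le> x \<Longrightarrow> t \<le> y \<Longrightarrow> \<bar>potential f x - potential f y\<bar> \<le> c"
  shows "oscillation t \<le> c"
  unfolding oscillation_def
proof (rule cSUP_least)
  show "{(f, x, y). unit_profile f \<and> t \<le> x \<and> t \<le> y} \<noteq> {}"
    using unit_profile_indicator by auto
qed (use assms in auto)

lemma oscillation_nonneg: "0 \<le> oscillation t"
  using oscillation_upper[OF unit_profile_indicator, of t t t] by simp

lemma oscillation_le: "oscillation t \<le> unit_bound"
  by (intro oscillation_least potential_diff_le)

lemma oscillation_antimono: "t \<le> t' \<Longrightarrow> oscillation t' \<le> oscillation t"
  by (intro oscillation_least oscillation_upper) auto

end

context spread_out_renewal begin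

text \<open>Let both starting points be at least \<open>t\<close> and stop both walks at the level \<open>l = t - L\<close>. The two overshoot
  laws share the mass \<open>\<epsilon>\<close>, which contributes nothing to the difference; on the rest the potentials differ
  by at most \<open>oscillation (l - A)\<close>, unless one of the overshoots exceeds \<open>A\<close>.\<close>

lemma oscillation_contraction:
  obtains \<epsilon> L where "0 < \<epsilon>" "\<epsilon> < 1" "1 \<le> L"
    "\<forall>t A. 1 \<le> A \<longrightarrow> L + 1 \<le> t \<longrightarrow> oscillation t \<le> (1 - \<epsilon>) * oscillation (t - L - A) + 2 * unit_bound * overshoot_bound A"
proof -
  obtain \<epsilon> L where \<epsilon>: "0 < \<epsilon>" "\<epsilon> < 1" and L: "1 \<le> L" and minor:
    "\<forall>g1 g2 \<phi>1 \<phi>2 C d. L \<le> g1 \<longrightarrow> L \<le> g2 \<longrightarrow> \<phi>1 \<in> borel_measurable borel \<longrightarrow> \<phi>2 \<in> borel_measurable borel \<longrightarrow>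
      (\<forall>r. \<phi>1 r \<le> ennreal C) \<longrightarrow> (\<forall>r. \<phi>2 r \<le> ennreal C) \<longrightarrow> (\<forall>r. ennreal d \<le> \<phi>1 r + \<phi>2 r) \<longrightarrow> 0 \<le> d \<longrightarrow>
      ennreal (\<epsilon> * d) \<le> (\<integral>\<^sup>+r. \<phi>1 r \<partial>overshoot g1) + (\<integral>\<^sup>+r. \<phi>2 r \<partial>overshoot g2)"
    by (rule overshoot_minorization)
  have key: "potential f x - potential f y \<le> (1 - \<epsilon>) * oscillation (t - L - A) + 2 * unit_bound * overshoot_bound A"
    if f: "unit_profile f" and x: "t \<le> x" and y: "t \<le> y" and A: "1 \<le> A" and t: "L + 1 \<le> t" for f x y t A
  proof -
    define l where "l = t - L"
    define w where "w = oscillation (l - A)"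
    define lo where "lo = (INF p\<in>{l - A..}. potential f p)"
    have w: "0 \<le> w" by (simp add: w_def oscillation_nonneg)
    have bdd: "bdd_below (potential f ` {l - A..})" by (intro bdd_belowI[of _ 0]) (auto simp: potential_nonneg)
    have lo_le: "lo \<le> potential f p" if "l - A \<le> p" for p
      unfolding lo_def using bdd that by (intro cINF_lower) auto
    have lo_K: "lo \<le> unit_bound" using lo_le[of "l - A"] potential_le[OF f, of "l - A"] by simp
    have lo_0: "0 \<le> lo" unfolding lo_def by (rule cINF_greatest) (auto simp: potential_nonneg)
    have hi: "potential f p \<le> lo + w" if p: "l - A \<le> p" for p
    proof -
      have "potential f p - w \<le> lo" unfolding lo_def
      proof (rule cINF_greatest)
        fix p' assume "p' \<in> {l - A..}"
        then show "potential f p - w \<le> potential f p'"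
          using oscillation_upper[OF f p, of p'] by (simp add: w_def)
      qed auto
      then show ?thesis by simp
    qed
    have [measurable]: "potential f \<in> borel_measurable borel" using f by (rule potential_measurable)
    \<comment> \<open>Below \<open>l - A\<close> only the trivial bounds \<open>0\<close> and \<open>unit_bound\<close> are known for the potential; the indicator term keeps both functions nonnegative there.\<close>
    define \<phi>1 where "\<phi>1 r = lo + w + unit_bound * indicator {A<..} r - potential f (l - r)" for r
    define \<phi>2 where "\<phi>2 r = potential f (l - r) - lo + unit_bound * indicator {A<..} r" for r
    have [measurable]: "\<phi>1 \<in> borel_measurable borel" "\<phi>2 \<in> borel_measurable borel"
      unfolding \<phi>1_def \<phi>2_def by measurable
    have nn: "0 \<le> \<phi>1 r" "0 \<le> \<phi>2 r" for r
      using hi[of "l - r"] lo_le[of "l - r"] potential_le[OF f, of "l - r"] potential_nonneg[of f "l - r"] w lo_0 lo_K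
      by (auto simp: \<phi>1_def \<phi>2_def indicator_def)
    have up: "\<phi>1 r \<le> 3 * unit_bound" "\<phi>2 r \<le> 3 * unit_bound" for r
      using lo_K lo_0 potential_le[OF f, of "l - r"] potential_nonneg[of f "l - r"] unit_bound_nonneg
        oscillation_le[of "l - A"]
      by (auto simp: \<phi>1_def \<phi>2_def w_def indicator_def)
    have passage: "potential f x' = (\<integral>r. potential f (l - r) \<partial>overshoot (x' - l))"
      and g: "L \<le> x' - l" "0 \<le> x' - l" if "t \<le> x'" for x'
    proof -
      show "L \<le> x' - l" "0 \<le> x' - l" using that L by (auto simp: l_def)
      then show "potential f x' = (\<integral>r. potential f (l - r) \<partial>overshoot (x' - l))"
        using potential_after_passage[OF f, of l "x' - l"] t by (simp add: l_def)
    qed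
    have int: "integrable (overshoot (x' - l)) (\<lambda>r. potential f (l - r))"
      "integrable (overshoot (x' - l)) (\<lambda>r. unit_bound * indicator {A<..} r :: real)"
      "integrable (overshoot (x' - l)) \<phi>1" "integrable (overshoot (x' - l)) \<phi>2"
      if "t \<le> x'" for x'
    proof -
      note bounded = integrable_overshoot_bounded[OF g(2)[OF that]]
      show "integrable (overshoot (x' - l)) (\<lambda>r. potential f (l - r))"
        using potential_le[OF f] potential_nonneg by (intro bounded[where C = unit_bound]) auto
      show "integrable (overshoot (x' - l)) (\<lambda>r. unit_bound * indicator {A<..} r :: real)"
        using unit_bound_nonneg by (intro bounded[where C = unit_bound]) (auto simp: indicator_def)
      show "integrable (overshoot (x' - l)) \<phi>1" "integrable (overshoot (x' - l)) \<phi>2"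
        using up nn by (intro bounded[where C = "3 * unit_bound"]; simp)+
    qed
    have I1: "(\<integral>r. \<phi>1 r \<partial>overshoot (x - l)) \<le> lo + w + unit_bound * overshoot_bound A - potential f x"
    proof -
      interpret O: prob_space "overshoot (x - l)" using g(2)[OF x] by (rule prob_space_overshoot)
      have "(\<integral>r. \<phi>1 r \<partial>overshoot (x - l)) = lo + w + unit_bound * measure (overshoot (x - l)) {A<..} - potential f x"
        unfolding \<phi>1_def passage[OF x] using int[OF x] O.prob_space by simp
      then show ?thesis using measure_overshoot_tail[OF A, of "x - l"] unit_bound_nonneg by (simp add: mult_left_mono)
    qed
    have I2: "(\<integral>r. \<phi>2 r \<partial>overshoot (y - l)) \<le> potential f y - lo + unit_bound * overshoot_bound A"
    proof -
      interpret O: prob_space "overshoot (y - l)" using g(2)[OF y] by (rule prob_space_overshoot)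
      have "(\<integral>r. \<phi>2 r \<partial>overshoot (y - l)) = potential f y - lo + unit_bound * measure (overshoot (y - l)) {A<..}"
        unfolding \<phi>2_def passage[OF y] using int[OF y] O.prob_space by simp
      then show ?thesis using measure_overshoot_tail[OF A, of "y - l"] unit_bound_nonneg by (simp add: mult_left_mono)
    qed
    have "ennreal (\<epsilon> * w) \<le> (\<integral>\<^sup>+r. ennreal (\<phi>1 r) \<partial>overshoot (x - l)) + (\<integral>\<^sup>+r. ennreal (\<phi>2 r) \<partial>overshoot (y - l))"
    proof (rule minor[rule_format, where C = "3 * unit_bound"])
      fix r
      have "w \<le> \<phi>1 r + \<phi>2 r" using unit_bound_nonneg by (simp add: \<phi>1_def \<phi>2_def)
      then show "ennreal w \<le> ennreal (\<phi>1 r) + ennreal (\<phi>2 r)"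
        using nn ennreal_leI[of w "\<phi>1 r + \<phi>2 r"] by simp
    qed (use g x y up w in \<open>auto intro: ennreal_leI\<close>)
    also have "\<dots> = ennreal ((\<integral>r. \<phi>1 r \<partial>overshoot (x - l)) + (\<integral>r. \<phi>2 r \<partial>overshoot (y - l)))"
      using nn int x y by (simp add: nn_integral_eq_integral)
    finally have "\<epsilon> * w \<le> (\<integral>r. \<phi>1 r \<partial>overshoot (x - l)) + (\<integral>r. \<phi>2 r \<partial>overshoot (y - l))"
      using nn by (subst (asm) ennreal_le_iff) (auto intro!: add_nonneg_nonneg Bochner_Integration.integral_nonneg)
    with I1 I2 show ?thesis by (simp add: w_def l_def algebra_simps)
  qed
  show ?thesis
  proof (rule that[OF \<epsilon> L], intro allI impI)
    fix t A :: real assume "1 \<le> A" "L + 1 \<le> t"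
    then have "\<bar>potential f x - potential f y\<bar>
        \<le> (1 - \<epsilon>) * oscillation (t - L - A) + 2 * unit_bound * overshoot_bound A"
      if "unit_profile f" "t \<le> x" "t \<le> y" for f x y
      using key[of f t x y A] key[of f t y x A] that unfolding abs_le_iff by auto
    then show "oscillation t \<le> (1 - \<epsilon>) * oscillation (t - L - A) + 2 * unit_bound * overshoot_bound A"
      by (rule oscillation_least)
  qed
qed

end

section \<open>Rate of convergence\<close>

text \<open>A contraction factor smaller than \<open>\<alpha> powr q\<close> per rescaling by \<open>\<alpha>\<close> beats the polynomial weight: the
  function \<open>w t = t powr q * W t\<close> satisfies \<open>w t \<le> \<kappa> * w (\<alpha> * t) + o(1)\<close> with \<open>\<kappa> < 1\<close>. Iteration shows first
  that \<open>w\<close> is bounded and then that it tends to \<open>0\<close>.\<close>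

lemma contraction_decay:
  fixes W R :: "real \<Rightarrow> real"
  assumes W0: "\<And>t. 0 \<le> W t" and WB: "\<And>t. W t \<le> B"
    and contr: "\<forall>\<^sub>F t in at_top. W t \<le> \<theta> * W (\<alpha> * t) + R t"
    and lam: "0 < \<alpha>" "\<alpha> < 1" and q: "0 \<le> q" and \<theta>: "0 \<le> \<theta>" "\<theta> < \<alpha> powr q"
    and R: "((\<lambda>t. t powr q * R t) \<longlongrightarrow> 0) at_top"
  shows "((\<lambda>t. t powr q * W t) \<longlongrightarrow> 0) at_top"
proof (rule tendstoI)
  fix e' :: real assume "0 < e'"
  define e where "e = e' / 3"
  have e: "0 < e" using \<open>0 < e'\<close> by (simp add: e_def)
  define w where "w t = t powr q * W t" for t
  define \<kappa> where "\<kappa> = \<theta> / \<alpha> powr q"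
  have \<kappa>: "0 \<le> \<kappa>" "\<kappa> < 1" using \<theta> lam by (auto simp: \<kappa>_def)
  have B0: "0 \<le> B" using W0[of 0] WB[of 0] by simp
  have "\<forall>\<^sub>F t in at_top. t powr q * R t < e * (1 - \<kappa>)"
    using order_tendstoD(2)[OF R] e \<kappa> by auto
  with contr eventually_ge_at_top[of "1::real"]
  have "\<forall>\<^sub>F t in at_top. w t \<le> \<kappa> * w (\<alpha> * t) + e * (1 - \<kappa>)"
  proof eventually_elim
    case (elim t)
    have "w t \<le> t powr q * (\<theta> * W (\<alpha> * t) + R t)"
      using elim unfolding w_def by (intro mult_left_mono) auto
    also have "\<dots> = \<kappa> * w (\<alpha> * t) + t powr q * R t"
      using lam elim by (simp add: w_def \<kappa>_def powr_mult field_simps)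
    finally show ?case using elim by linarith
  qed
  then obtain t1 where t1: "\<And>t. t1 \<le> t \<Longrightarrow> w t \<le> \<kappa> * w (\<alpha> * t) + e * (1 - \<kappa>)" "1 \<le> t1"
    unfolding eventually_at_top_linorder by (metis linorder_linear order_trans)
  define B' where "B' = t1 powr q * B"
  have B': "0 \<le> B'" using B0 by (simp add: B'_def)
  have init: "w t \<le> B'" if "0 < t" "t \<le> t1" for t
    unfolding w_def B'_def using that q W0 WB B0 by (intro mult_mono powr_mono2) auto
  have step: "\<kappa> * x + e * (1 - \<kappa>) \<le> \<kappa> * y + e" if "x \<le> y + e" for x y
  proof -
    have "\<kappa> * x \<le> \<kappa> * (y + e)" using that \<kappa> by (intro mult_left_mono) auto
    then show ?thesis by (simp add: algebra_simps)
  qed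
  \<comment> \<open>Induction on the number of rescalings by \<open>\<alpha>\<close> that bring \<open>t\<close> below \<open>t1\<close>.\<close>
  have bounded: "w t \<le> B' + e" if "0 < t" for t
  proof -
    have *: "w t \<le> B' + e" if "0 < t" "\<alpha> ^ n * t \<le> t1" for n t
      using that
    proof (induction n arbitrary: t)
      case 0
      then show ?case using init[of t] e by simp
    next
      case (Suc n)
      show ?case
      proof (cases "t \<le> t1")
        case True
        then show ?thesis using init[of t] Suc.prems e by simp
      next
        case False
        have "w (\<alpha> * t) \<le> B' + e" using Suc.prems lam by (intro Suc.IH) (auto simp: mult.assoc mult.left_commute)
        then have "\<kappa> * w (\<alpha> * t) + e * (1 - \<kappa>) \<le> \<kappa> * B' + e" by (rule step)
        also have "\<dots> \<le> B' + e" using mult_right_mono[of \<kappa> 1 B'] \<kappa> B' by simp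
        finally show ?thesis using t1(1)[of t] False by simp
      qed
    qed
    obtain n where "\<alpha> ^ n < t1 / t"
      using real_arch_pow_inv[of "t1 / t" \<alpha>] lam t1(2) \<open>0 < t\<close> by auto
    then show ?thesis using \<open>0 < t\<close> by (intro *[of t n]) (auto simp: field_simps)
  qed
  have decay: "w t \<le> \<kappa> ^ n * (B' + e) + e" if "0 < t" "t1 \<le> \<alpha> ^ n * t" for n t
    using that
  proof (induction n arbitrary: t)
    case 0
    then show ?case using bounded[of t] e by simp
  next
    case (Suc n)
    have "\<alpha> ^ Suc n * t \<le> 1 * t" using Suc.prems lam by (intro mult_right_mono power_le_one) auto
    then have t: "t1 \<le> t" using Suc.prems(2) by linarith
    have "w (\<alpha> * t) \<le> \<kappa> ^ n * (B' + e) + e"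
      using Suc.prems lam by (intro Suc.IH) (auto simp: mult.assoc mult.left_commute)
    then have "\<kappa> * w (\<alpha> * t) + e * (1 - \<kappa>) \<le> \<kappa> * (\<kappa> ^ n * (B' + e)) + e" by (rule step)
    then show ?case using t1(1)[OF t] by simp
  qed
  obtain n where n: "\<kappa> ^ n < e / (B' + e)"
    using real_arch_pow_inv[of "e / (B' + e)" \<kappa>] \<kappa> e B' by auto
  have ev: "\<forall>\<^sub>F t in at_top. w t < e'"
    using eventually_ge_at_top[of "t1 / \<alpha> ^ n"] eventually_gt_at_top[of 0]
  proof eventually_elim
    case (elim t)
    have "w t \<le> \<kappa> ^ n * (B' + e) + e" using elim lam by (intro decay) (auto simp: field_simps)
    moreover have "\<kappa> ^ n * (B' + e) < e" using n e B' by (simp add: field_simps)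
    ultimately show ?case using e by (simp add: e_def)
  qed
  show "\<forall>\<^sub>F t in at_top. dist (t powr q * W t) 0 < e'"
    using ev by eventually_elim (use W0 in \<open>simp add: w_def\<close>)
qed

context spread_out_renewal begin

text \<open>On \<open>t > a\<close> one has \<open>a powr (s - 1) * t \<le> t powr s\<close>, and the tail of a convergent integral vanishes.\<close>

lemma overshoot_bound_rate:
  assumes s: "1 < s" and mom: "integrable F (\<lambda>t. t powr s)"
  shows "((\<lambda>a. a powr (s - 1) * overshoot_bound a) \<longlongrightarrow> 0) at_top"
proof -
  have "((\<lambda>a. \<integral>t. t powr s * indicator {a<..} t \<partial>F) \<longlongrightarrow> (\<integral>t. 0 \<partial>F)) at_top"
  proof (rule integral_dominated_convergence_at_top[where w = "\<lambda>t. t powr s"])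
    show "AE t in F. ((\<lambda>a. t powr s * indicator {a<..} t) \<longlongrightarrow> 0) at_top"
    proof (rule AE_I2)
      fix t :: real
      have "\<forall>\<^sub>F a in at_top. t powr s * indicator {a<..} t = 0"
        using eventually_ge_at_top[of t] by eventually_elim auto
      then show "((\<lambda>a. t powr s * indicator {a<..} t) \<longlongrightarrow> 0) at_top" by (rule tendsto_eventually)
    qed
    show "\<forall>\<^sub>F a in at_top. AE t in F. norm (t powr s * indicator {a<..} t) \<le> t powr s"
      by (intro always_eventually allI AE_I2) (simp add: indicator_def)
  qed (use mom in measurable)
  then have lim: "((\<lambda>a. unit_bound * (\<integral>t. t powr s * indicator {a<..} t \<partial>F)) \<longlongrightarrow> unit_bound * 0) at_top"
    by (intro tendsto_mult_left) simp
  have upper: "\<forall>\<^sub>F a in at_top. a powr (s - 1) * overshoot_bound a \<le> unit_bound * (\<integral>t. t powr s * indicator {a<..} t \<partial>F)"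
    using eventually_gt_at_top[of 0]
  proof eventually_elim
    case (elim a)
    have "a powr (s - 1) * (\<integral>t. t * indicator {a<..} t \<partial>F) = (\<integral>t. a powr (s - 1) * (t * indicator {a<..} t) \<partial>F)"
      by simp
    also have "\<dots> \<le> (\<integral>t. t powr s * indicator {a<..} t \<partial>F)"
    proof (rule integral_mono)
      show "integrable F (\<lambda>t. a powr (s - 1) * (t * indicator {a<..} t))"
        by (intro integrable_mult_right integrable_tail)
      show "integrable F (\<lambda>t. t powr s * indicator {a<..} t)"
        using integrable_mult_indicator[OF _ mom, of "{a<..}"] by (simp add: mult.commute)
      fix t :: real
      show "a powr (s - 1) * (t * indicator {a<..} t) \<le> t powr s * indicator {a<..} t"
      proof (cases "a < t")
        case True
        have "a powr (s - 1) * t \<le> t powr (s - 1) * t"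
          using True elim s by (intro mult_right_mono powr_mono2) auto
        also have "\<dots> = t powr s" using True elim by (simp add: powr_diff)
        finally show ?thesis using True by simp
      qed simp
    qed
    finally show ?case using unit_bound_nonneg by (simp add: overshoot_bound_def mult_left_mono mult.left_commute)
  qed
  have lower: "\<forall>\<^sub>F a in at_top. 0 \<le> a powr (s - 1) * overshoot_bound a"
    using eventually_ge_at_top[of 0] by eventually_elim (auto intro!: mult_nonneg_nonneg overshoot_bound_nonneg)
  show ?thesis
    using lim by (intro tendsto_sandwich[OF lower upper tendsto_const]) simp
qed

text \<open>In the contraction inequality, \<open>A\<close> is chosen proportional to \<open>t\<close>, with a factor so small that the scale
  \<open>\<alpha>\<close> satisfies \<open>1 - \<epsilon> < \<alpha> powr (s - 1)\<close>.\<close>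

lemma oscillation_rate:
  assumes s: "1 < s" and mom: "integrable F (\<lambda>t. t powr s)"
  shows "((\<lambda>t. t powr (s - 1) * oscillation t) \<longlongrightarrow> 0) at_top"
proof -
  obtain \<epsilon> L where \<epsilon>: "0 < \<epsilon>" "\<epsilon> < 1" and L: "1 \<le> L" and contr:
    "\<forall>t A. 1 \<le> A \<longrightarrow> L + 1 \<le> t \<longrightarrow> oscillation t \<le> (1 - \<epsilon>) * oscillation (t - L - A) + 2 * unit_bound * overshoot_bound A"
    by (rule oscillation_contraction)
  define \<alpha> where "\<alpha> = (1 - \<epsilon> / 2) powr (1 / (s - 1))"
  have lam: "0 < \<alpha>" "\<alpha> < 1" "\<alpha> powr (s - 1) = 1 - \<epsilon> / 2"
  proof -
    show "0 < \<alpha>" using \<epsilon> by (simp add: \<alpha>_def)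
    show "\<alpha> < 1" using \<epsilon> s powr_less_mono2[of "1 / (s - 1)" "1 - \<epsilon> / 2" 1] by (simp add: \<alpha>_def)
    show "\<alpha> powr (s - 1) = 1 - \<epsilon> / 2" using \<epsilon> s by (simp add: \<alpha>_def powr_powr)
  qed
  define \<eta> where "\<eta> = (1 - \<alpha>) / 2"
  have \<eta>: "0 < \<eta>" using lam by (simp add: \<eta>_def)
  show ?thesis
  proof (rule contraction_decay[where \<theta> = "1 - \<epsilon>" and \<alpha> = \<alpha> and R = "\<lambda>t. 2 * unit_bound * overshoot_bound (\<eta> * t)" and B = unit_bound])
    show "\<forall>\<^sub>F t in at_top. oscillation t \<le> (1 - \<epsilon>) * oscillation (\<alpha> * t) + 2 * unit_bound * overshoot_bound (\<eta> * t)"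
      using eventually_ge_at_top[of "L + 1"] eventually_ge_at_top[of "L / \<eta>"]
    proof eventually_elim
      case (elim t)
      have Lt: "L \<le> \<eta> * t" using elim \<eta> by (simp add: field_simps)
      have "oscillation t \<le> (1 - \<epsilon>) * oscillation (t - L - \<eta> * t) + 2 * unit_bound * overshoot_bound (\<eta> * t)"
        using contr Lt L elim by auto
      moreover have "(1 - \<epsilon>) * oscillation (t - L - \<eta> * t) \<le> (1 - \<epsilon>) * oscillation (\<alpha> * t)"
        using \<epsilon> Lt by (intro mult_left_mono oscillation_antimono) (auto simp: \<eta>_def field_simps)
      ultimately show ?case by simp
    qed
    have "filterlim (\<lambda>t. \<eta> * t) at_top at_top"
      using \<eta> by (intro filterlim_tendsto_pos_mult_at_top[OF tendsto_const _ filterlim_ident])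
    then have "((\<lambda>t. (\<eta> * t) powr (s - 1) * overshoot_bound (\<eta> * t)) \<longlongrightarrow> 0) at_top"
      by (rule filterlim_compose[OF overshoot_bound_rate[OF s mom]])
    then have lim: "((\<lambda>t. 2 * unit_bound * \<eta> powr (1 - s) * ((\<eta> * t) powr (s - 1) * overshoot_bound (\<eta> * t))) \<longlongrightarrow> 2 * unit_bound * \<eta> powr (1 - s) * 0) at_top"
      by (intro tendsto_mult_left)
    have eq: "\<forall>\<^sub>F t in at_top. 2 * unit_bound * \<eta> powr (1 - s) * ((\<eta> * t) powr (s - 1) * overshoot_bound (\<eta> * t))
        = t powr (s - 1) * (2 * unit_bound * overshoot_bound (\<eta> * t))"
      using eventually_gt_at_top[of 0]
    proof eventually_elim
      case (elim t)
      have "\<eta> powr (1 - s) * (\<eta> * t) powr (s - 1) = t powr (s - 1)"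
        using \<eta> elim powr_add[of \<eta> "1 - s" "s - 1"] by (simp add: powr_mult)
      then have "(\<eta> powr (1 - s) * (\<eta> * t) powr (s - 1)) * (2 * unit_bound * overshoot_bound (\<eta> * t))
          = t powr (s - 1) * (2 * unit_bound * overshoot_bound (\<eta> * t))" by (rule arg_cong)
      then show ?case by (simp only: ac_simps)
    qed
    show "((\<lambda>t. t powr (s - 1) * (2 * unit_bound * overshoot_bound (\<eta> * t))) \<longlongrightarrow> 0) at_top"
      using Lim_transform_eventually[OF lim eq] unfolding mult_zero_right .
  qed (use \<epsilon> s lam in \<open>auto simp: oscillation_nonneg oscillation_le\<close>)
qed

lemma oscillation_tendsto_0:
  assumes s: "1 < s" and mom: "integrable F (\<lambda>t. t powr s)"
  shows "(oscillation \<longlongrightarrow> 0) at_top"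
proof (rule tendsto_sandwich[OF _ _ tendsto_const oscillation_rate[OF s mom]])
  show "\<forall>\<^sub>F t in at_top. oscillation t \<le> t powr (s - 1) * oscillation t"
    using eventually_ge_at_top[of 1]
  proof eventually_elim
    case (elim t)
    then have "1 \<le> t powr (s - 1)" using s by (intro ge_one_powr_ge_zero) auto
    then show ?case using mult_right_mono[of 1 "t powr (s - 1)" "oscillation t"] oscillation_nonneg by simp
  qed
qed (simp add: oscillation_nonneg)

end

section \<open>Limits of potentials and the renewal constant\<close>

context renewal_law begin

lemma integrable_profile:
  assumes "unit_profile f"
  shows "integrable lborel f"
proof (rule Bochner_Integration.integrable_bound[where f = "indicator {0..<1::real} :: real \<Rightarrow> real"])
  show "AE x in lborel. norm (f x) \<le> norm (indicator {0..<1::real} x :: real)"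
    using unit_profileD[OF assms] by (auto simp: indicator_def)
qed (use unit_profileD[OF assms] in auto)

lemma integral_profile:
  assumes "unit_profile f"
  shows "0 \<le> (\<integral>x. f x \<partial>lborel)" "(\<integral>x. f x \<partial>lborel) \<le> 1"
proof -
  show "0 \<le> (\<integral>x. f x \<partial>lborel)" using unit_profileD[OF assms] by simp
  have "(\<integral>x. f x \<partial>lborel) \<le> (\<integral>x. indicator {0..<1::real} x \<partial>lborel)"
    using unit_profileD[OF assms]
    by (intro integral_mono integrable_profile[OF assms] integrable_profile[OF unit_profile_indicator])
      (auto simp: indicator_def)
  then show "(\<integral>x. f x \<partial>lborel) \<le> 1" by simp
qed

text \<open>Both sides are the value at \<open>x\<close> of \<open>f * h * \<Phi>\<close>.\<close>

lemma potential_duality: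
  assumes f: "unit_profile f" and h: "unit_profile h"
  shows "(\<integral>\<^sup>+s. ennreal (h s * potential f (x - s)) \<partial>lborel) = (\<integral>\<^sup>+v. ennreal (f v * potential h (x - v)) \<partial>lborel)"
proof -
  interpret P: pair_sigma_finite lborel \<Phi> ..
  have [measurable]: "f \<in> borel_measurable borel" "h \<in> borel_measurable borel"
    using f h by (auto intro: unit_profileD)
  have expand: "(\<integral>\<^sup>+s. ennreal (h s * potential f (x - s)) \<partial>lborel)
     = (\<integral>\<^sup>+u. \<integral>\<^sup>+s. ennreal (h s) * ennreal (f (x - s - u)) \<partial>lborel \<partial>\<Phi>)"
    if f: "unit_profile f" and h: "unit_profile h" for f h
  proof -
    have [measurable]: "f \<in> borel_measurable borel" "h \<in> borel_measurable borel"
      using f h by (auto intro: unit_profileD)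
    have "(\<integral>\<^sup>+s. ennreal (h s * potential f (x - s)) \<partial>lborel)
       = (\<integral>\<^sup>+s. \<integral>\<^sup>+u. ennreal (h s) * ennreal (f (x - s - u)) \<partial>\<Phi> \<partial>lborel)"
    proof (rule nn_integral_cong)
      fix s
      have "ennreal (h s * potential f (x - s)) = ennreal (h s) * ennreal (potential f (x - s))"
        by (intro ennreal_mult unit_profileD[OF h] potential_nonneg)
      also have "\<dots> = (\<integral>\<^sup>+u. ennreal (h s) * ennreal (f (x - s - u)) \<partial>\<Phi>)"
        by (subst nn_integral_cmult) (auto simp: ennreal_potential[OF f])
      finally show "ennreal (h s * potential f (x - s)) = (\<integral>\<^sup>+u. ennreal (h s) * ennreal (f (x - s - u)) \<partial>\<Phi>)" .
    qed
    also have "\<dots> = (\<integral>\<^sup>+u. \<integral>\<^sup>+s. ennreal (h s) * ennreal (f (x - s - u)) \<partial>lborel \<partial>\<Phi>)"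
      by (rule P.Fubini'[symmetric]) measurable
    finally show ?thesis .
  qed
  have "(\<integral>\<^sup>+s. ennreal (h s) * ennreal (f (x - s - u)) \<partial>lborel)
      = (\<integral>\<^sup>+v. ennreal (f v) * ennreal (h (x - v - u)) \<partial>lborel)" for u
    by (subst nn_integral_real_affine[where c = "-1" and t = "x - u"]) (auto simp: algebra_simps)
  then show ?thesis unfolding expand[OF f h] expand[OF h f] by simp
qed

text \<open>Vanishing oscillation makes each potential converge, to \<open>lim f\<close> say. Averaging the potential of \<open>f\<close>
  against \<open>h\<close> and letting \<open>x\<close> tend to infinity turns duality into \<open>lim f * \<integral>h = lim h * \<integral>f\<close>, so \<open>lim f\<close> is
  proportional to \<open>\<integral>f\<close>. The value \<open>\<kappa>\<close> is the limit for the indicator of the unit interval.\<close>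

lemma potential_limit:
  assumes osc: "(oscillation \<longlongrightarrow> 0) at_top"
  obtains \<kappa> where "\<forall>f x. unit_profile f \<longrightarrow> \<bar>potential f x - \<kappa> * (\<integral>y. f y \<partial>lborel)\<bar> \<le> oscillation x"
proof -
  have ex: "\<exists>c. \<forall>x. \<bar>potential f x - c\<bar> \<le> oscillation x" if f: "unit_profile f" for f
  proof -
    have osc_nat: "(\<lambda>n. oscillation (real n)) \<longlonglongrightarrow> 0"
      using osc filterlim_real_sequentially by (rule filterlim_compose)
    have "Cauchy (\<lambda>n. potential f (real n))"
    proof (rule metric_CauchyI)
      fix e :: real assume "0 < e"
      then obtain N where "oscillation (real N) < e"
        using order_tendstoD(2)[OF osc_nat] by (meson eventually_sequentially order_refl)
      then have "dist (potential f (real m)) (potential f (real n)) < e" if "N \<le> m" "N \<le> n" for m n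
        using oscillation_upper[OF f, of "real N" "real m" "real n"] that by (simp add: dist_real_def)
      then show "\<exists>M. \<forall>m\<ge>M. \<forall>n\<ge>M. dist (potential f (real m)) (potential f (real n)) < e" by blast
    qed
    then obtain c where c: "(\<lambda>n. potential f (real n)) \<longlonglongrightarrow> c"
      using Cauchy_convergent_iff convergent_def by blast
    have "\<bar>potential f x - c\<bar> \<le> oscillation x" for x
    proof (rule LIMSEQ_le_const2)
      show "(\<lambda>n. \<bar>potential f x - potential f (real n)\<bar>) \<longlonglongrightarrow> \<bar>potential f x - c\<bar>"
        using c by (intro tendsto_intros)
      show "\<exists>N. \<forall>n\<ge>N. \<bar>potential f x - potential f (real n)\<bar> \<le> oscillation x"
      proof (intro exI allI impI)
        fix n assume "nat \<lceil>x\<rceil> \<le> n"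
        then have "x \<le> real n" by linarith
        then show "\<bar>potential f x - potential f (real n)\<bar> \<le> oscillation x"
          by (intro oscillation_upper[OF f]) auto
      qed
    qed
    then show ?thesis by blast
  qed
  define lim where "lim f = (SOME c. \<forall>x. \<bar>potential f x - c\<bar> \<le> oscillation x)" for f
  have lim: "\<bar>potential f x - lim f\<bar> \<le> oscillation x" if "unit_profile f" for f x
    using someI_ex[OF ex[OF that]] by (simp add: lim_def)
  have average: "\<bar>(\<integral>s. h s * potential f (x - s) \<partial>lborel) - lim f * (\<integral>s. h s \<partial>lborel)\<bar> \<le> oscillation (x - 1)"
    and average_int: "integrable lborel (\<lambda>s. h s * potential f (x - s))"
    if f: "unit_profile f" and h: "unit_profile h" for f h x
  proof -
    have [measurable]: "h \<in> borel_measurable borel" "potential f \<in> borel_measurable borel"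
      using h f by (auto intro: unit_profileD potential_measurable)
    have int_h: "integrable lborel h" using h by (rule integrable_profile)
    show int: "integrable lborel (\<lambda>s. h s * potential f (x - s))"
    proof (rule Bochner_Integration.integrable_bound[where f = "\<lambda>s. unit_bound * h s"])
      have "h s * potential f (x - s) \<le> unit_bound * h s" for s
        using mult_left_mono[OF potential_le[OF f, of "x - s"] unit_profileD(2)[OF h, of s]] by (simp add: mult.commute)
      then show "AE s in lborel. norm (h s * potential f (x - s)) \<le> norm (unit_bound * h s)"
        using unit_profileD(2)[OF h] potential_nonneg unit_bound_nonneg by simp
    qed (use int_h in auto)
    have "\<bar>(\<integral>s. h s * potential f (x - s) \<partial>lborel) - lim f * (\<integral>s. h s \<partial>lborel)\<bar>
        = \<bar>\<integral>s. h s * (potential f (x - s) - lim f) \<partial>lborel\<bar>"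
      using int int_h by (simp add: right_diff_distrib mult.commute[of _ "lim f"])
    also have "\<dots> \<le> (\<integral>s. h s * oscillation (x - 1) \<partial>lborel)"
    proof (rule integral_abs_bound[THEN order_trans], rule integral_mono)
      show "integrable lborel (\<lambda>s. \<bar>h s * (potential f (x - s) - lim f)\<bar>)"
        using int int_h by (auto simp: right_diff_distrib)
      fix s
      show "\<bar>h s * (potential f (x - s) - lim f)\<bar> \<le> h s * oscillation (x - 1)"
      proof (cases "s \<in> {0..<1}")
        case True
        have "\<bar>potential f (x - s) - lim f\<bar> \<le> oscillation (x - 1)"
          using lim[OF f, of "x - s"] oscillation_antimono[of "x - 1" "x - s"] True by simp
        then show ?thesis using unit_profileD(2)[OF h, of s] by (simp add: abs_mult mult_left_mono)
      qed (use unit_profileD(4)[OF h, of s] in auto)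
    qed (use int_h in auto)
    also have "\<dots> = (\<integral>s. h s \<partial>lborel) * oscillation (x - 1)" by simp
    also have "\<dots> \<le> oscillation (x - 1)"
      using integral_profile[OF h] oscillation_nonneg[of "x - 1"] by (simp add: mult_left_le_one_le)
    finally show "\<bar>(\<integral>s. h s * potential f (x - s) \<partial>lborel) - lim f * (\<integral>s. h s \<partial>lborel)\<bar> \<le> oscillation (x - 1)" .
  qed
  have swap: "lim f * (\<integral>s. h s \<partial>lborel) = lim h * (\<integral>s. f s \<partial>lborel)"
    if f: "unit_profile f" and h: "unit_profile h" for f h
  proof -
    let ?d = "lim f * (\<integral>s. h s \<partial>lborel) - lim h * (\<integral>s. f s \<partial>lborel)"
    have bound: "\<bar>?d\<bar> \<le> 2 * oscillation (x - 1)" for x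
    proof -
      have "(\<integral>s. h s * potential f (x - s) \<partial>lborel) = (\<integral>v. f v * potential h (x - v) \<partial>lborel)"
        using potential_duality[OF f h, of x] average_int[OF f h, of x] average_int[OF h f, of x]
          unit_profileD(2)[OF f] unit_profileD(2)[OF h] potential_nonneg
        by (simp add: nn_integral_eq_integral)
      then show ?thesis using average[OF f h, of x] average[OF h f, of x] by linarith
    qed
    have "filterlim (\<lambda>x::real. x - 1) at_top at_top"
      unfolding filterlim_at_top
    proof
      fix Z :: real show "\<forall>\<^sub>F x in at_top. Z \<le> x - 1"
        using eventually_ge_at_top[of "Z + 1"] by eventually_elim simp
    qed
    then have "((\<lambda>x. 2 * oscillation (x - 1)) \<longlongrightarrow> 2 * 0) at_top"
      by (intro tendsto_mult_left filterlim_compose[OF osc])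
    then have "\<bar>?d\<bar> \<le> 2 * 0" using bound by (intro tendsto_lowerbound) auto
    then show ?thesis by simp
  qed
  let ?one = "indicator {0..<1::real} :: real \<Rightarrow> real"
  have lim_eq: "lim f = lim ?one * (\<integral>y. f y \<partial>lborel)" if "unit_profile f" for f
    using swap[OF that unit_profile_indicator] by simp
  have "\<forall>f x. unit_profile f \<longrightarrow> \<bar>potential f x - lim ?one * (\<integral>y. f y \<partial>lborel)\<bar> \<le> oscillation x"
    using lim lim_eq by (metis (no_types, lifting))
  then show ?thesis by (rule that)
qed

text \<open>On the cell \<open>[k, k + 1)\<close> the function \<open>z\<close> is \<open>c k\<close> times a translated profile, so its convolution with \<open>\<Phi>\<close>
  is a series of potentials at the points \<open>x - k\<close>.\<close>

lemma convolution_error_le: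
  fixes z :: "real \<Rightarrow> real" and c :: "nat \<Rightarrow> real"
  assumes lim: "\<forall>f x. unit_profile f \<longrightarrow> \<bar>potential f x - \<kappa> * (\<integral>y. f y \<partial>lborel)\<bar> \<le> oscillation x"
    and [measurable]: "z \<in> borel_measurable borel"
    and nonneg: "\<And>y. 0 \<le> z y" and supp: "\<And>y. y < 0 \<Longrightarrow> z y = 0"
    and c: "\<And>k y. real k \<le> y \<Longrightarrow> y < real k + 1 \<Longrightarrow> z y \<le> c k" and sum_c: "summable c"
  shows "summable (\<lambda>k. c k * oscillation (x - real k))"
    and "\<bar>(\<integral>v. z (x - v) \<partial>\<Phi>) - \<kappa> * (\<integral>y. z y \<partial>lborel)\<bar> \<le> (\<Sum>k. c k * oscillation (x - real k))"
proof -
  have c0: "0 \<le> c k" for k using nonneg[of "real k"] c[of k "real k"] by simp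
  \<comment> \<open>Where \<open>c k = 0\<close> the function \<open>z\<close> vanishes on the cell, and the zero profile serves.\<close>
  define f where "f k y = (if c k = 0 then 0 else z (y + real k) * indicator {0..<1} y / c k)" for k y
  have prof: "unit_profile (f k)" for k
  proof -
    have "f k y \<le> 1" for y
      using c[of k "y + real k"] c0[of k] nonneg[of "y + real k"] by (auto simp: f_def indicator_def divide_le_eq)
    moreover have "f k \<in> borel_measurable borel" unfolding f_def by measurable
    ultimately show ?thesis using c0 nonneg by (auto simp: unit_profile_def f_def)
  qed
  have [measurable]: "f k \<in> borel_measurable borel" for k using prof by (rule unit_profileD)
  have f0: "0 \<le> f k y" for k y using prof by (rule unit_profileD)
  have cf: "c k * f k (y - real k) = z y * indicator {real k..<real k + 1} y" for k y
    using c[of k y] nonneg[of y] by (auto simp: f_def indicator_def)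
  have pieces: "ennreal (z y) = (\<Sum>k. ennreal (c k * f k (y - real k)))" for y
  proof (cases "y < 0")
    case True
    then show ?thesis unfolding cf by (simp add: supp indicator_def)
  next
    case False
    then obtain n :: nat where n: "real n \<le> y" "y < real n + 1"
      by (intro that[of "nat \<lfloor>y\<rfloor>"]) linarith+
    have other: "y \<notin> {real k..<real k + 1}" if "k \<noteq> n" for k using n that by auto
    have "(\<Sum>k. ennreal (c k * f k (y - real k))) = (\<Sum>k\<in>{n}. ennreal (c k * f k (y - real k)))"
      by (rule suminf_finite) (use other in \<open>auto simp: cf\<close>)
    also have "\<dots> = ennreal (z y)" using n by (simp add: cf)
    finally show ?thesis by simp
  qed
  have sum1: "summable (\<lambda>k. c k * potential (f k) (x - real k))"
    by (rule summable_comparison_test'[OF summable_mult2[OF sum_c, of unit_bound], of 0])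
      (use c0 potential_le[OF prof] potential_nonneg in \<open>auto simp: abs_mult intro!: mult_left_mono\<close>)
  have sum2: "summable (\<lambda>k. c k * (\<integral>y. f k y \<partial>lborel))"
    by (rule summable_comparison_test'[OF sum_c, of 0])
      (use c0 integral_profile[OF prof] in \<open>auto simp: abs_mult intro: mult_left_le\<close>)
  show sum3: "summable (\<lambda>k. c k * oscillation (x - real k))"
    by (rule summable_comparison_test'[OF summable_mult2[OF sum_c, of unit_bound], of 0])
      (use c0 oscillation_le oscillation_nonneg in \<open>auto simp: abs_mult intro!: mult_left_mono\<close>)
  have "(\<integral>\<^sup>+v. ennreal (z (x - v)) \<partial>\<Phi>) = (\<Sum>k. \<integral>\<^sup>+v. ennreal (c k * f k (x - v - real k)) \<partial>\<Phi>)"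
    unfolding pieces by (rule nn_integral_suminf) measurable
  also have "\<dots> = (\<Sum>k. ennreal (c k * potential (f k) (x - real k)))"
  proof (rule suminf_cong)
    fix k
    have "(\<integral>\<^sup>+v. ennreal (c k * f k (x - v - real k)) \<partial>\<Phi>) = (\<integral>\<^sup>+v. ennreal (c k) * ennreal (f k (x - real k - v)) \<partial>\<Phi>)"
      by (intro nn_integral_cong) (simp add: ennreal_mult c0 f0 algebra_simps)
    also have "\<dots> = ennreal (c k * potential (f k) (x - real k))"
      by (subst nn_integral_cmult) (auto simp: ennreal_mult c0 potential_nonneg ennreal_potential[OF prof])
    finally show "(\<integral>\<^sup>+v. ennreal (c k * f k (x - v - real k)) \<partial>\<Phi>) = ennreal (c k * potential (f k) (x - real k))" .
  qed
  also have "\<dots> = ennreal (\<Sum>k. c k * potential (f k) (x - real k))"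
    using sum1 c0 potential_nonneg by (intro suminf_ennreal2) auto
  finally have conv: "(\<integral>v. z (x - v) \<partial>\<Phi>) = (\<Sum>k. c k * potential (f k) (x - real k))"
    using nonneg sum1 c0 potential_nonneg by (subst integral_eq_nn_integral) (auto intro!: enn2real_ennreal suminf_nonneg mult_nonneg_nonneg)
  have "(\<integral>\<^sup>+y. ennreal (z y) \<partial>lborel) = (\<Sum>k. \<integral>\<^sup>+y. ennreal (c k * f k (y - real k)) \<partial>lborel)"
    unfolding pieces by (rule nn_integral_suminf) measurable
  also have "\<dots> = (\<Sum>k. ennreal (c k * (\<integral>y. f k y \<partial>lborel)))"
  proof (rule suminf_cong)
    fix k
    have "(\<integral>\<^sup>+y. ennreal (c k * f k (y - real k)) \<partial>lborel) = (\<integral>\<^sup>+y. ennreal (c k * f k y) \<partial>lborel)"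
      by (subst nn_integral_real_affine[where c = 1 and t = "real k"]) auto
    also have "\<dots> = ennreal (\<integral>y. c k * f k y \<partial>lborel)"
      by (intro nn_integral_eq_integral integrable_mult_right integrable_profile[OF prof]) (auto simp: c0 f0)
    finally show "(\<integral>\<^sup>+y. ennreal (c k * f k (y - real k)) \<partial>lborel) = ennreal (c k * (\<integral>y. f k y \<partial>lborel))" by simp
  qed
  also have "\<dots> = ennreal (\<Sum>k. c k * (\<integral>y. f k y \<partial>lborel))"
    using sum2 c0 integral_profile(1)[OF prof] by (intro suminf_ennreal2) auto
  finally have integ: "(\<integral>y. z y \<partial>lborel) = (\<Sum>k. c k * (\<integral>y. f k y \<partial>lborel))"
    using nonneg sum2 c0 integral_profile(1)[OF prof]
    by (subst integral_eq_nn_integral) (auto intro!: enn2real_ennreal suminf_nonneg mult_nonneg_nonneg)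
  have sum4: "summable (\<lambda>k. c k * (potential (f k) (x - real k) - \<kappa> * (\<integral>y. f k y \<partial>lborel)))"
    using summable_diff[OF sum1 summable_mult[OF sum2, of \<kappa>]] by (simp add: algebra_simps)
  have "(\<integral>v. z (x - v) \<partial>\<Phi>) - \<kappa> * (\<integral>y. z y \<partial>lborel)
      = (\<Sum>k. c k * (potential (f k) (x - real k) - \<kappa> * (\<integral>y. f k y \<partial>lborel)))"
    unfolding conv integ using suminf_diff[OF sum1 summable_mult[OF sum2, of \<kappa>]] suminf_mult[OF sum2, of \<kappa>]
    by (simp add: algebra_simps)
  also have "\<bar>\<dots>\<bar> \<le> (\<Sum>k. c k * oscillation (x - real k))"
  proof (rule norm_suminf_le[where 'a = real, unfolded real_norm_def, OF _ sum3])
    fix k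
    have "\<bar>potential (f k) (x - real k) - \<kappa> * (\<integral>y. f k y \<partial>lborel)\<bar> \<le> oscillation (x - real k)"
      using lim prof by blast
    then show "\<bar>c k * (potential (f k) (x - real k) - \<kappa> * (\<integral>y. f k y \<partial>lborel))\<bar> \<le> c k * oscillation (x - real k)"
      using c0[of k] by (simp add: abs_mult mult_left_mono)
  qed
  finally show "\<bar>(\<integral>v. z (x - v) \<partial>\<Phi>) - \<kappa> * (\<integral>y. z y \<partial>lborel)\<bar> \<le> (\<Sum>k. c k * oscillation (x - real k))" .
qed

text \<open>For \<open>k < N\<close> the argument \<open>x - k\<close> is still at least \<open>x / 2\<close>; for the remaining cells the trivial bound on
  the oscillation is used, and smallness comes from \<open>c\<close>.\<close>

lemma oscillation_sum_split:
  fixes c :: "nat \<Rightarrow> real"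
  assumes c0: "\<And>k. 0 \<le> c k" and sum_c: "summable c" and sum_osc: "summable (\<lambda>k. c k * oscillation (x - real k))"
    and N: "real N \<le> x / 2 + 1"
  shows "(\<Sum>k. c k * oscillation (x - real k)) \<le> oscillation (x / 2) * (\<Sum>k. c k) + unit_bound * (\<Sum>k. c (k + N))"
proof -
  have tail: "summable (\<lambda>k. c (k + N) * oscillation (x - real (k + N)))"
    using sum_osc summable_iff_shift[of "\<lambda>k. c k * oscillation (x - real k)" N] by simp
  have tail_c: "summable (\<lambda>k. c (k + N))" using sum_c by (simp add: summable_iff_shift)
  have "(\<Sum>k. c k * oscillation (x - real k))
      = (\<Sum>k. c (k + N) * oscillation (x - real (k + N))) + (\<Sum>k<N. c k * oscillation (x - real k))"
    by (rule suminf_split_initial_segment[OF sum_osc])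
  also have "(\<Sum>k. c (k + N) * oscillation (x - real (k + N))) \<le> (\<Sum>k. unit_bound * c (k + N))"
    using tail tail_c c0 oscillation_le
    by (intro suminf_le summable_mult) (auto simp: mult.commute[of unit_bound] intro!: mult_left_mono)
  also have "(\<Sum>k. unit_bound * c (k + N)) = unit_bound * (\<Sum>k. c (k + N))" using tail_c by (rule suminf_mult)
  also have "(\<Sum>k<N. c k * oscillation (x - real k)) \<le> (\<Sum>k<N. c k * oscillation (x / 2))"
  proof (intro sum_mono mult_left_mono oscillation_antimono c0)
    fix k assume "k \<in> {..<N}"
    then have "real k + 1 \<le> real N" by simp
    then show "x / 2 \<le> x - real k" using N by linarith
  qed
  also have "\<dots> = oscillation (x / 2) * (\<Sum>k<N. c k)" by (simp add: sum_distrib_right mult.commute)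
  also have "\<dots> \<le> oscillation (x / 2) * (\<Sum>k. c k)"
    using c0 sum_c by (intro mult_left_mono sum_le_suminf oscillation_nonneg) auto
  finally show ?thesis by simp
qed

end

context spread_out_renewal begin

text \<open>The total mass of an overshoot law is \<open>1\<close>, which says that the convolution of \<open>\<Phi>\<close> with the tail function
  \<open>y \<mapsto> F (y, \<infinity>)\<close> is identically \<open>1\<close> on the half-line. The integral of the tail function is the mean, so
  comparison with the limit \<open>\<kappa>\<close> times that integral determines \<open>\<kappa>\<close>.\<close>

lemma renewal_constant:
  assumes s: "1 < s" and mom: "integrable F (\<lambda>t. t powr s)"
    and lim: "\<forall>f x. unit_profile f \<longrightarrow> \<bar>potential f x - \<kappa> * (\<integral>y. f y \<partial>lborel)\<bar> \<le> oscillation x"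
  shows "\<kappa> * (\<integral>t. t \<partial>F) = 1"
proof -
  define z where "z y = indicator {0..} y * measure F {y<..}" for y :: real
  \<comment> \<open>The tail function is decreasing, so its supremum over a cell is its value at the left end.\<close>
  define c where "c k = measure F {real k<..}" for k :: nat
  have decr: "measure F {y'<..} \<le> measure F {y<..}" if "y \<le> y'" for y y' :: real
    using that by (intro F.finite_measure_mono) auto
  have meas_tail [measurable]: "(\<lambda>y. measure F {y<..}) \<in> borel_measurable borel"
  proof -
    have "mono (\<lambda>y. - measure F {y<..})" using decr by (auto simp: mono_def)
    then have "(\<lambda>y. - (- measure F {y<..})) \<in> borel_measurable borel"
      by (intro borel_measurable_uminus borel_measurable_mono)
    then show ?thesis by simp
  qed
  have [measurable]: "z \<in> borel_measurable borel" unfolding z_def by measurable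
  have z0: "0 \<le> z y" for y by (simp add: z_def)
  \<comment> \<open>Markov's inequality for the \<open>s\<close>-th moment.\<close>
  have sum_c: "summable c"
  proof (rule summable_comparison_test_ev)
    show "summable (\<lambda>k. (\<integral>t. t powr s \<partial>F) * real k powr (- s))"
      using s by (intro summable_mult) (simp add: summable_real_powr_iff)
    show "\<forall>\<^sub>F k in sequentially. norm (c k) \<le> (\<integral>t. t powr s \<partial>F) * real k powr (- s)"
      using eventually_ge_at_top[of 1]
    proof eventually_elim
      case (elim k)
      have "real k powr s * c k = (\<integral>t. real k powr s * indicator {real k<..} t \<partial>F)"
        by (simp add: c_def)
      also have "\<dots> \<le> (\<integral>t. t powr s \<partial>F)"
      proof (intro integral_mono mom integrable_mult_right)
        show "integrable F (\<lambda>t. indicator {real k<..} t :: real)"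
          by (intro F.integrable_const_bound[where B = 1]) auto
        show "real k powr s * indicator {real k<..} t \<le> t powr s" for t
          using s by (auto simp: indicator_def intro!: powr_mono2)
      qed
      finally have le: "real k powr (- s) * (real k powr s * c k) \<le> real k powr (- s) * (\<integral>t. t powr s \<partial>F)"
        by (intro mult_left_mono) auto
      have eq: "real k powr (- s) * (real k powr s * c k) = c k"
        using elim by (simp add: mult.assoc[symmetric] powr_add[symmetric])
      have "0 \<le> c k" by (simp add: c_def)
      then show ?case using le unfolding eq by (simp add: mult.commute)
    qed
  qed
  have mean: "(\<integral>y. z y \<partial>lborel) = (\<integral>t. t \<partial>F)"
  proof -
    interpret P: pair_sigma_finite lborel F ..
    have "(\<integral>\<^sup>+y. ennreal (z y) \<partial>lborel) = (\<integral>\<^sup>+y. \<integral>\<^sup>+t. indicator {0..} y * indicator {0<..} (t - y) \<partial>F \<partial>lborel)"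
    proof (rule nn_integral_cong)
      fix y :: real
      have "(\<integral>\<^sup>+t. indicator {0<..} (t - y) \<partial>F) = (\<integral>\<^sup>+t. indicator {y<..} t \<partial>F)"
        by (intro nn_integral_cong) (auto simp: indicator_def)
      also have "\<dots> = ennreal (measure F {y<..})" by (simp add: F.emeasure_eq_measure)
      finally show "ennreal (z y) = (\<integral>\<^sup>+t. indicator {0..} y * indicator {0<..} (t - y) \<partial>F)"
        by (cases "0 \<le> y") (simp_all add: z_def)
    qed
    also have "\<dots> = (\<integral>\<^sup>+t. \<integral>\<^sup>+y. indicator {0..} y * indicator {0<..} (t - y) \<partial>lborel \<partial>F)"
      by (rule P.Fubini'[symmetric]) measurable
    also have "\<dots> = (\<integral>\<^sup>+t. ennreal t \<partial>F)"
    proof (intro nn_integral_cong_AE, use pos_F in eventually_elim)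
      fix t :: real assume "0 < t"
      have "(\<integral>\<^sup>+y. indicator {0..} y * indicator {0<..} (t - y) \<partial>lborel) = (\<integral>\<^sup>+y. indicator {0..<t} y \<partial>lborel)"
        by (intro nn_integral_cong) (auto simp: indicator_def)
      then show "(\<integral>\<^sup>+y. indicator {0..} y * indicator {0<..} (t - y) \<partial>lborel) = ennreal t"
        using \<open>0 < t\<close> by simp
    qed
    also have "\<dots> = ennreal (\<integral>t. t \<partial>F)"
      using pos_F by (intro nn_integral_eq_integral finite_mean) (auto elim!: eventually_mono)
    finally have "(\<integral>\<^sup>+y. ennreal (z y) \<partial>lborel) = ennreal (\<integral>t. t \<partial>F)" .
    moreover have "0 \<le> (\<integral>t. t \<partial>F)"
      using pos_F by (intro integral_nonneg_AE) (auto elim!: eventually_mono)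
    ultimately show ?thesis using z0 by (subst integral_eq_nn_integral) auto
  qed
  have one: "(\<integral>v. z (x - v) \<partial>\<Phi>) = 1" if "0 \<le> x" for x
  proof -
    interpret O: prob_space "overshoot x" using that by (rule prob_space_overshoot)
    have "1 = (\<integral>\<^sup>+r. 1 \<partial>overshoot x)" by (simp add: O.emeasure_space_1[simplified])
    also have "\<dots> = (\<integral>\<^sup>+v. ennreal (z (x - v)) \<partial>\<Phi>)"
    proof (subst nn_integral_overshoot, simp, rule nn_integral_cong)
      fix v
      have "(\<integral>\<^sup>+t. indicator {x<..} (v + t) * 1 \<partial>F) = (\<integral>\<^sup>+t. indicator {x - v<..} t \<partial>F)"
        by (intro nn_integral_cong) (auto simp: indicator_def)
      also have "\<dots> = ennreal (measure F {x - v<..})" by (simp add: F.emeasure_eq_measure)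
      finally show "indicator {..x} v * (\<integral>\<^sup>+t. indicator {x<..} (v + t) * 1 \<partial>F) = ennreal (z (x - v))"
        by (cases "v \<le> x") (simp_all add: z_def)
    qed
    finally show ?thesis using z0 by (subst integral_eq_nn_integral) auto
  qed
  note err = convolution_error_le[OF lim, of z c]
  have osc: "(oscillation \<longlongrightarrow> 0) at_top" using s mom by (rule oscillation_tendsto_0)
  have bound: "\<bar>1 - \<kappa> * (\<integral>t. t \<partial>F)\<bar> \<le> oscillation (real N) * (\<Sum>k. c k) + unit_bound * (\<Sum>k. c (k + N))" for N
  proof -
    have zc: "z y \<le> c k" if "real k \<le> y" "y < real k + 1" for k y
      using decr[OF that(1)] by (auto simp: z_def c_def indicator_def)
    have zs: "z y = 0" if "y < 0" for y using that by (simp add: z_def)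
    have "\<bar>1 - \<kappa> * (\<integral>t. t \<partial>F)\<bar> \<le> (\<Sum>k. c k * oscillation (2 * real N - real k))"
      using err(2)[OF _ z0 zs zc sum_c, of "2 * real N"] one[of "2 * real N"] by (simp add: mean)
    also have "\<dots> \<le> oscillation (2 * real N / 2) * (\<Sum>k. c k) + unit_bound * (\<Sum>k. c (k + N))"
      by (intro oscillation_sum_split sum_c err(1)[OF _ z0 zs zc sum_c]) (auto simp: c_def)
    finally show ?thesis by simp
  qed
  have "(\<lambda>N. \<Sum>k. c (k + N)) \<longlonglongrightarrow> 0"
  proof -
    have "(\<lambda>N. (\<Sum>k. c k) - (\<Sum>k<N. c k)) \<longlonglongrightarrow> (\<Sum>k. c k) - (\<Sum>k. c k)"
      by (intro tendsto_intros summable_LIMSEQ sum_c)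
    moreover have "(\<Sum>k. c k) - (\<Sum>k<N. c k) = (\<Sum>k. c (k + N))" for N
      using suminf_split_initial_segment[OF sum_c, of N] by linarith
    ultimately show ?thesis by simp
  qed
  then have "(\<lambda>N. oscillation (real N) * (\<Sum>k. c k) + unit_bound * (\<Sum>k. c (k + N))) \<longlonglongrightarrow> 0 * (\<Sum>k. c k) + unit_bound * 0"
    by (intro tendsto_intros filterlim_compose[OF osc filterlim_real_sequentially])
  then have "\<bar>1 - \<kappa> * (\<integral>t. t \<partial>F)\<bar> \<le> 0 * (\<Sum>k. c k) + unit_bound * 0"
    by (rule tendsto_lowerbound) (use bound in auto)
  then show ?thesis by simp
qed

end

section \<open>The expansion\<close>

text \<open>Comparison with the integral of \<open>x powr (- r)\<close>, carried out as a telescoping sum.\<close>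

lemma suminf_powr_tail_le:
  assumes r: "1 < r" and N: "2 \<le> N"
  shows "summable (\<lambda>k. real (k + N) powr (- r))"
    and "(\<Sum>k. real (k + N) powr (- r)) \<le> (real N - 1) powr (1 - r) / (r - 1)"
proof -
  show sm: "summable (\<lambda>k. real (k + N) powr (- r))"
    using r summable_iff_shift[of "\<lambda>k. real k powr (- r)" N] by (simp add: summable_real_powr_iff)
  define g where "g k = (real (k + N) - 1) powr (1 - r) / (r - 1)" for k
  have step: "real (k + N) powr (- r) \<le> g k - g (Suc k)" for k
  proof -
    define a where "a = real (k + N) - 1"
    have a: "1 \<le> a" using N by (simp add: a_def)
    have "\<exists>\<xi>. a < \<xi> \<and> \<xi> < a + 1 \<and> (a + 1) powr (1 - r) - a powr (1 - r) = (a + 1 - a) * ((1 - r) * \<xi> powr (- r))"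
    proof (rule MVT2)
      fix x assume "a \<le> x" "x \<le> a + 1"
      then have "((\<lambda>x. x powr (1 - r)) has_real_derivative (1 - r) * x powr (1 - r - 1)) (at x)"
        using a by (intro has_real_derivative_powr) auto
      then show "((\<lambda>x. x powr (1 - r)) has_real_derivative (1 - r) * x powr (- r)) (at x)" by simp
    qed simp
    then obtain \<xi> where xi: "a < \<xi>" "\<xi> < a + 1" "(a + 1) powr (1 - r) - a powr (1 - r) = (1 - r) * \<xi> powr (- r)"
      by auto
    have "(a + 1) powr (- r) \<le> \<xi> powr (- r)" using xi a r by (intro powr_mono2') auto
    also have "\<dots> = (a powr (1 - r) - (a + 1) powr (1 - r)) / (r - 1)"
      using xi(3) r by (simp add: field_simps)
    finally show ?thesis by (simp add: g_def a_def diff_divide_distrib add.commute)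
  qed
  have "(\<Sum>k. real (k + N) powr (- r)) \<le> g 0"
  proof (rule suminf_le_const[OF sm])
    fix n
    have "(\<Sum>k<n. real (k + N) powr (- r)) \<le> (\<Sum>k<n. g k - g (Suc k))" by (intro sum_mono step)
    also have "\<dots> = g 0 - g n" by (rule sum_lessThan_telescope')
    also have "\<dots> \<le> g 0" using r by (simp add: g_def)
    finally show "(\<Sum>k<n. real (k + N) powr (- r)) \<le> g 0" .
  qed
  then show "(\<Sum>k. real (k + N) powr (- r)) \<le> (real N - 1) powr (1 - r) / (r - 1)" by (simp add: g_def)
qed

context spread_out_renewal begin

text \<open>The constant \<open>D\<close> depends neither on the constant \<open>C\<close> in the decay of \<open>z\<close> nor on \<open>\<delta>\<close>. A fixed \<open>C\<close>
  therefore gives the big-O statement, and arbitrarily small \<open>C\<close> and \<open>\<delta>\<close> give the little-o statement.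
  All \<open>q \<le> s - 1\<close> are covered at once, because the oscillation already decays like \<open>o(x powr (1 - s))\<close>.\<close>

lemma renewal_expansion:
  assumes s: "1 < s" and mom: "integrable F (\<lambda>t. t powr s)" and r: "1 < r"
    and [measurable]: "z \<in> borel_measurable borel"
    and nonneg: "\<And>y. 0 \<le> z y" and supp: "\<And>y. y < 0 \<Longrightarrow> z y = 0" and bounded: "\<And>y. z y \<le> b"
    and decay: "\<forall>\<^sub>F y in at_top. z y \<le> C0 * y powr (- r)"
  obtains D where "0 \<le> D"
    "\<And>C \<delta> q. 0 \<le> C \<Longrightarrow> \<forall>\<^sub>F y in at_top. z y \<le> C * y powr (- r) \<Longrightarrow> 0 < \<delta> \<Longrightarrow> q \<le> s - 1 \<Longrightarrow>
      \<forall>\<^sub>F x in at_top. \<bar>(\<integral>v. z (x - v) \<partial>\<Phi>) - inverse (\<integral>t. t \<partial>F) * (\<integral>y. z y \<partial>lborel)\<bar>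
        \<le> (\<delta> + D * C) * x powr max (1 - r) (- q)"
proof -
  obtain \<kappa> where \<kappa>:
    "\<forall>f x. unit_profile f \<longrightarrow> \<bar>potential f x - \<kappa> * (\<integral>y. f y \<partial>lborel)\<bar> \<le> oscillation x"
    by (rule potential_limit[OF oscillation_tendsto_0[OF s mom]])
  have \<kappa>_eq: "\<kappa> = inverse (\<integral>t. t \<partial>F)"
    using renewal_constant[OF s mom \<kappa>] by (metis inverse_unique mult.commute)
  define c where "c k = (SUP y\<in>{real k..<real k + 1}. z y)" for k :: nat
  have ne: "{real k..<real k + 1} \<noteq> {}" for k by simp
  have bdd: "bdd_above (z ` {real k..<real k + 1})" for k using bounded by (auto intro!: bdd_aboveI[of _ b])
  have zc: "z y \<le> c k" if "real k \<le> y" "y < real k + 1" for k y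
    unfolding c_def using bdd that by (intro cSUP_upper) auto
  have c0: "0 \<le> c k" for k using zc[of k "real k"] nonneg[of "real k"] by simp
  have cell: "c k \<le> C * real k powr (- r)"
    if "\<And>y. Y \<le> y \<Longrightarrow> z y \<le> C * y powr (- r)" "Y \<le> real k" "1 \<le> k" "0 \<le> C" for C Y k
    unfolding c_def
  proof (rule cSUP_least[OF ne])
    fix y assume y: "y \<in> {real k..<real k + 1}"
    then have "z y \<le> C * y powr (- r)" using that by auto
    also have "\<dots> \<le> C * real k powr (- r)"
      using y that r by (intro mult_left_mono powr_mono2') auto
    finally show "z y \<le> C * real k powr (- r)" .
  qed
  have sum_c: "summable c"
  proof -
    have "\<forall>\<^sub>F y in at_top. z y \<le> \<bar>C0\<bar> * y powr (- r)"
      using decay by eventually_elim (auto elim!: order_trans intro!: mult_right_mono)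
    then obtain Y where Y: "\<And>y. Y \<le> y \<Longrightarrow> z y \<le> \<bar>C0\<bar> * y powr (- r)"
      unfolding eventually_at_top_linorder by blast
    show ?thesis
    proof (rule summable_comparison_test_ev)
      show "summable (\<lambda>k. \<bar>C0\<bar> * real k powr (- r))"
        using r by (intro summable_mult) (simp add: summable_real_powr_iff)
      show "\<forall>\<^sub>F k in sequentially. norm (c k) \<le> \<bar>C0\<bar> * real k powr (- r)"
        using eventually_ge_at_top[of "max 1 (nat \<lceil>Y\<rceil>)"]
      proof eventually_elim
        case (elim k)
        then have "1 \<le> k" "nat \<lceil>Y\<rceil> \<le> k" by simp_all
        then have k: "Y \<le> real k" "1 \<le> k" by linarith+
        have "c k \<le> \<bar>C0\<bar> * real k powr (- r)" by (rule cell[OF Y k]) simp_all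
        then show ?case using c0[of k] by simp
      qed
    qed
  qed
  define S where "S = (\<Sum>k. c k)"
  define D where "D = unit_bound * ((1/4) powr (1 - r) / (r - 1))"
  have S0: "0 \<le> S" unfolding S_def using sum_c c0 by (rule suminf_nonneg)
  have D0: "0 \<le> D" unfolding D_def using unit_bound_nonneg r by simp
  let ?err = "\<lambda>x. (\<integral>v. z (x - v) \<partial>\<Phi>) - \<kappa> * (\<integral>y. z y \<partial>lborel)"
  have raw: "\<forall>\<^sub>F x in at_top. \<bar>?err x\<bar> \<le> S * oscillation (x / 2) + D * C * x powr (1 - r)"
    if C: "0 \<le> C" and ev: "\<forall>\<^sub>F y in at_top. z y \<le> C * y powr (- r)" for C
  proof -
    obtain Y where Y: "\<And>y. Y \<le> y \<Longrightarrow> z y \<le> C * y powr (- r)"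
      using ev unfolding eventually_at_top_linorder by blast
    show ?thesis
      using eventually_ge_at_top[of 8] eventually_ge_at_top[of "2 * (Y + 1)"]
    proof eventually_elim
      case (elim x)
      \<comment> \<open>The choice \<open>N = \<lfloor>x / 2\<rfloor>\<close>; the bound \<open>x \<ge> 8\<close> ensures \<open>x / 4 \<le> N - 1\<close>.\<close>
      obtain N :: nat where N: "real N \<le> x / 2" "x / 2 < real N + 1"
        using elim by (intro that[of "nat \<lfloor>x / 2\<rfloor>"]) linarith+
      have N2: "2 \<le> N" using N elim by linarith
      have NY: "Y \<le> real N" using N elim by (simp add: field_simps)
      have Nx: "x / 4 \<le> real N - 1" using N elim by (simp add: field_simps)
      have sum_tail: "summable (\<lambda>k. c (k + N))" using sum_c by (simp add: summable_iff_shift)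
      have "(\<Sum>k. c (k + N)) \<le> (\<Sum>k. C * real (k + N) powr (- r))"
        using N2 NY C by (intro suminf_le sum_tail summable_mult suminf_powr_tail_le(1) r cell[OF Y]) auto
      also have "\<dots> = C * (\<Sum>k. real (k + N) powr (- r))"
        by (intro suminf_mult suminf_powr_tail_le(1) r N2)
      also have "\<dots> \<le> C * ((real N - 1) powr (1 - r) / (r - 1))"
        by (intro mult_left_mono suminf_powr_tail_le(2) r N2 C)
      also have "\<dots> \<le> C * ((x / 4) powr (1 - r) / (r - 1))"
        using Nx elim r C by (intro mult_left_mono divide_right_mono powr_mono2') auto
      also have "\<dots> = C * ((1/4) powr (1 - r) / (r - 1)) * x powr (1 - r)"
        using elim powr_mult[of "1/4" x "1 - r"] by simp
      finally have "unit_bound * (\<Sum>k. c (k + N)) \<le> unit_bound * (C * ((1/4) powr (1 - r) / (r - 1)) * x powr (1 - r))"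
        using unit_bound_nonneg by (intro mult_left_mono)
      then have tail: "unit_bound * (\<Sum>k. c (k + N)) \<le> D * C * x powr (1 - r)"
        by (simp add: D_def ac_simps)
      have "\<bar>?err x\<bar> \<le> (\<Sum>k. c k * oscillation (x - real k))"
        using \<kappa> _ nonneg supp zc sum_c by (rule convolution_error_le(2)) measurable
      also have "\<dots> \<le> oscillation (x / 2) * (\<Sum>k. c k) + unit_bound * (\<Sum>k. c (k + N))"
      proof (rule oscillation_sum_split[OF c0 sum_c])
        show "summable (\<lambda>k. c k * oscillation (x - real k))"
          using \<kappa> _ nonneg supp zc sum_c by (rule convolution_error_le(1)) measurable
      qed (use N in simp)
      finally show ?case using tail by (simp add: S_def mult.commute)
    qed
  qed
  have half: "((\<lambda>x. S * 2 powr (s - 1) * ((x / 2) powr (s - 1) * oscillation (x / 2))) \<longlongrightarrow> S * 2 powr (s - 1) * 0) at_top"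
  proof (intro tendsto_mult_left filterlim_compose[OF oscillation_rate[OF s mom]])
    show "filterlim (\<lambda>x::real. x / 2) at_top at_top"
      using filterlim_tendsto_pos_mult_at_top[OF tendsto_const[of "1/2"] _ filterlim_ident] by simp
  qed
  show ?thesis
  proof (rule that[OF D0])
    fix C \<delta> q :: real
    assume C: "0 \<le> C" "\<forall>\<^sub>F y in at_top. z y \<le> C * y powr (- r)" and \<delta>: "0 < \<delta>" and q: "q \<le> s - 1"
    have "\<forall>\<^sub>F x in at_top. S * 2 powr (s - 1) * ((x / 2) powr (s - 1) * oscillation (x / 2)) < \<delta>"
      using order_tendstoD(2)[OF half] \<delta> by simp
    with raw[OF C] eventually_ge_at_top[of 1]
    show "\<forall>\<^sub>F x in at_top. \<bar>(\<integral>v. z (x - v) \<partial>\<Phi>) - inverse (\<integral>t. t \<partial>F) * (\<integral>y. z y \<partial>lborel)\<bar>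
        \<le> (\<delta> + D * C) * x powr max (1 - r) (- q)"
      unfolding \<kappa>_eq[symmetric]
    proof eventually_elim
      case (elim x)
      let ?p = "x powr max (1 - r) (- q)"
      have "x powr (1 - s) * (x powr (s - 1) * (S * oscillation (x / 2))) = S * oscillation (x / 2)"
        using elim by (simp add: mult.assoc[symmetric] powr_add[symmetric])
      moreover have "x powr (s - 1) * (S * oscillation (x / 2)) \<le> \<delta>"
        using elim powr_mult[of 2 "x / 2" "s - 1"] by (simp add: ac_simps)
      ultimately have "S * oscillation (x / 2) \<le> x powr (1 - s) * \<delta>"
        by (metis mult_left_mono powr_ge_zero)
      also have "\<dots> \<le> \<delta> * ?p"
        using elim q \<delta> by (subst mult.commute, intro mult_left_mono powr_mono) auto
      finally have "S * oscillation (x / 2) \<le> \<delta> * ?p" .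
      moreover have "D * C * x powr (1 - r) \<le> D * C * ?p"
        using elim C D0 by (intro mult_left_mono powr_mono) auto
      ultimately show ?case using elim by (simp add: algebra_simps)
    qed
  qed
qed

end

theorem theorem1p5:
  fixes M :: "'a measure"
    and \<tau> :: "nat \<Rightarrow> 'a \<Rightarrow> real"
    and F :: "real measure"
    and m s r :: real
    and z :: "real \<Rightarrow> real"
  assumes "prob_space M"
    and "prob_space.indep_vars M (\<lambda>_. borel) \<tau> {1..}"
    and "\<And>n. n \<ge> 1 \<Longrightarrow> distr M borel (\<tau> n) = F"
    and "\<And>n \<omega>. n \<ge> 1 \<Longrightarrow> \<omega> \<in> space M \<Longrightarrow> \<tau> n \<omega> > 0"
    and "integrable M (\<tau> 1)"
    and "inverse m = (LINT \<omega>|M. \<tau> 1 \<omega>)"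
    and "spread_out F"
    and "s \<ge> 2"
    and "(\<integral>\<^sup>+ \<omega>. ennreal (\<tau> 1 \<omega> powr s) \<partial>M) < \<infinity>"
    and "set_borel_measurable borel {0..} z"
    and "\<And>x. x \<ge> 0 \<Longrightarrow> z x \<ge> 0"
    and "set_integrable lborel {0..} z"
    and "bounded (z ` {0..})"
    and "r > 1"
    and "z \<in> O[at_top](\<lambda>x. x powr (- r))"
  shows "(\<forall>q. 0 \<le> q \<and> q \<le> s - 1 \<longrightarrow>
            (\<lambda>x. renewal_conv F z x - m * (LINT y:{0..}|lborel. z y))
              \<in> O[at_top](\<lambda>x. x powr (max (1 - r) (- q)))) \<and>
         (z \<in> o[at_top](\<lambda>x. x powr (- r)) \<longrightarrow>
            (\<forall>q. 0 \<le> q \<and> q \<le> s - 1 \<longrightarrow>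
              (\<lambda>x. renewal_conv F z x - m * (LINT y:{0..}|lborel. z y))
                \<in> o[at_top](\<lambda>x. x powr (max (1 - r) (- q)))))"
proof -
  interpret M: prob_space M by fact
  define X where "X = \<tau> 1"
  have int_X: "integrable M X" unfolding X_def by fact
  then have [measurable]: "X \<in> borel_measurable M" by (rule borel_measurable_integrable)
  have F: "distr M borel X = F" unfolding X_def by (rule assms(3)) simp
  have pos_X: "0 < X \<omega>" if "\<omega> \<in> space M" for \<omega>
    unfolding X_def using that by (intro assms(4)) simp
  have "renewal_law F"
  proof (rule renewal_law.intro)
    show "prob_space F" unfolding F[symmetric] by (rule M.prob_space_distr) measurable
    show "sets F = sets borel" unfolding F[symmetric] by simp
    show "AE t in F. 0 < t" unfolding F[symmetric] using pos_X by (subst AE_distr_iff) auto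
  qed
  moreover have "integrable F (\<lambda>t. t)"
    unfolding F[symmetric] using int_X by (subst integrable_distr_eq) auto
  ultimately interpret spread_out_renewal F
    using assms(7) by (intro spread_out_renewal.intro spread_out_renewal_axioms.intro)
  have mom: "integrable F (\<lambda>t. t powr s)"
    unfolding F[symmetric] using assms(9)[folded X_def]
    by (subst integrable_distr_eq) (auto intro!: integrableI_nonneg)
  have m: "inverse (\<integral>t. t \<partial>F) = m"
  proof -
    have "(\<integral>t. t \<partial>F) = (\<integral>\<omega>. X \<omega> \<partial>M)"
      unfolding F[symmetric] by (subst integral_distr) auto
    then show ?thesis using assms(6)[folded X_def] by (metis inverse_inverse_eq)
  qed
  \<comment> \<open>The values of \<open>z\<close> at negative arguments are arbitrary, hence this extension by zero.\<close>
  define z0 where "z0 y = indicator {0..} y * z y" for y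
  have meas_z0 [measurable]: "z0 \<in> borel_measurable borel"
    using assms(10) unfolding set_borel_measurable_def z0_def by simp
  have z0: "0 \<le> z0 y" for y using assms(11)[of y] by (simp add: z0_def indicator_def)
  obtain b where "\<And>y. 0 \<le> y \<Longrightarrow> \<bar>z y\<bar> \<le> b" using assms(13) by (auto simp: bounded_iff)
  then have b: "z0 y \<le> \<bar>b\<bar>" for y by (fastforce simp: z0_def indicator_def abs_le_iff)
  have conv: "renewal_conv F z x = (\<integral>v. z0 (x - v) \<partial>\<Phi>)" for x
    unfolding renewal_conv_def set_lebesgue_integral_def
  proof (rule integral_cong_AE)
    have "(\<lambda>v. indicator {0..} v * z0 (x - v)) \<in> borel_measurable \<Phi>" by measurable
    then show "(\<lambda>v. indicator {0..x} v *\<^sub>R z (x - v)) \<in> borel_measurable \<Phi>"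
      by (rule measurable_cong[THEN iffD1, rotated]) (auto simp: z0_def indicator_def)
    show "AE v in \<Phi>. indicator {0..x} v *\<^sub>R z (x - v) = z0 (x - v)"
      using AE_renewal_nonneg by eventually_elim (auto simp: z0_def indicator_def)
  qed measurable
  have int_z: "(LINT y:{0..}|lborel. z y) = (\<integral>y. z0 y \<partial>lborel)"
    by (simp add: set_lebesgue_integral_def z0_def)
  have decay: "\<forall>\<^sub>F y in at_top. z0 y \<le> C * y powr (- r)"
    if "\<forall>\<^sub>F y in at_top. norm (z y) \<le> C * norm (y powr (- r))" for C
    using that eventually_ge_at_top[of 0] by eventually_elim (auto simp: z0_def)
  obtain C0 where C0: "0 < C0" "\<forall>\<^sub>F y in at_top. norm (z y) \<le> C0 * norm (y powr (- r))"
    using assms(15) by (rule landau_o.bigE)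
  let ?err = "\<lambda>x. renewal_conv F z x - m * (LINT y:{0..}|lborel. z y)"
  have "\<exists>D\<ge>0. \<forall>C \<delta> q. 0 \<le> C \<longrightarrow> (\<forall>\<^sub>F y in at_top. z0 y \<le> C * y powr (- r)) \<longrightarrow> 0 < \<delta> \<longrightarrow> q \<le> s - 1 \<longrightarrow>
      (\<forall>\<^sub>F x in at_top. \<bar>?err x\<bar> \<le> (\<delta> + D * C) * x powr max (1 - r) (- q))"
  proof (rule renewal_expansion[OF _ mom \<open>r > 1\<close> meas_z0 z0 _ b decay[OF C0(2)]])
    fix D :: real
    assume "0 \<le> D" and "\<And>C \<delta> q. 0 \<le> C \<Longrightarrow> \<forall>\<^sub>F y in at_top. z0 y \<le> C * y powr (- r) \<Longrightarrow> 0 < \<delta> \<Longrightarrow> q \<le> s - 1 \<Longrightarrow>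
      \<forall>\<^sub>F x in at_top. \<bar>(\<integral>v. z0 (x - v) \<partial>\<Phi>) - inverse (\<integral>t. t \<partial>F) * (\<integral>y. z0 y \<partial>lborel)\<bar>
        \<le> (\<delta> + D * C) * x powr max (1 - r) (- q)"
    then show ?thesis unfolding conv int_z m by blast
  qed (use assms(8) in \<open>auto simp: z0_def\<close>)
  then obtain D where D: "0 \<le> D" and expansion: "\<And>C \<delta> q. 0 \<le> C \<Longrightarrow> \<forall>\<^sub>F y in at_top. z0 y \<le> C * y powr (- r) \<Longrightarrow>
      0 < \<delta> \<Longrightarrow> q \<le> s - 1 \<Longrightarrow> \<forall>\<^sub>F x in at_top. \<bar>?err x\<bar> \<le> (\<delta> + D * C) * x powr max (1 - r) (- q)"
    by blast
  show ?thesis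
  proof (intro conjI impI allI)
    fix q assume q: "0 \<le> q \<and> q \<le> s - 1"
    show "?err \<in> O(\<lambda>x. x powr max (1 - r) (- q))"
      by (rule bigoI[where c = "1 + D * C0"])
        (use expansion[OF _ decay[OF C0(2)], of 1 q] C0 q in simp)
  next
    fix q assume small: "z \<in> o(\<lambda>x. x powr - r)" and q: "0 \<le> q \<and> q \<le> s - 1"
    show "?err \<in> o(\<lambda>x. x powr max (1 - r) (- q))"
    proof (rule landau_o.smallI)
      fix e :: real assume e: "0 < e"
      define C where "C = e / 2 / (D + 1)"
      have C: "0 < C" using e D by (simp add: C_def)
      have "D * C \<le> (D + 1) * C" using C by simp
      also have "\<dots> = e / 2" using D by (simp add: C_def field_simps)
      finally have DC: "e / 2 + D * C \<le> e" by simp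
      have "\<forall>\<^sub>F x in at_top. \<bar>?err x\<bar> \<le> (e / 2 + D * C) * x powr max (1 - r) (- q)"
        using C e q by (intro expansion decay landau_o.smallD[OF small]) auto
      then show "\<forall>\<^sub>F x in at_top. norm (?err x) \<le> e * norm (x powr max (1 - r) (- q))"
      proof eventually_elim
        case (elim x)
        also have "(e / 2 + D * C) * x powr max (1 - r) (- q) \<le> e * x powr max (1 - r) (- q)"
          using DC by (intro mult_right_mono) auto
        finally show ?case by simp
      qed
    qed
  qed
qed

end
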